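(* Alice has $A^1\in\mathbb{R}^{n\times d}$ and Bob has $A^2\in\mathbb{R}^{n\times d}$. Let $A\in\mathbb{R}^{n\times d}$ be given by $A_{i,j}=f(A^1_{i,j}+A^2_{i,j})$. If $f(x)=\Omega(|x|^p)$ and $p>1$, then the communication of computing, with constant probability greater than $1/2$, a rank-$k$ projection matrix $P$ such that $$\|A-AP\|_F^2\le(1+\varepsilon)\|A-[A]_k\|_F^2$$ is at least $$\tilde\Omega\left((1+\varepsilon)^{-\frac{2}{p}}\,n^{1-\frac1p}\,d^{1-\frac4p}\right)$$ bits.
   Context: Here $f:\mathbb{R}\to\mathbb{R}$ is a specific function known to both players, $k$ is a positive integer, $\varepsilon>0$, and $n\gg d$. $P$ is a $d\times d$ projection matrix; $\|\cdot\|_F$ is the Frobenius norm, $\|A\|_F^2=\sum_{i,j}A_{i,j}^2$; $[A]_k$ is the best rank-$k$ approximation to $A$, given by the singular value decomposition. Communication is the number of bits exchanged between Alice and Bob by a protocol that computes $P$. $\tilde\Omega(\cdot)$ denotes $\Omega(\cdot)$ with polylogarithmic factors suppressed. *)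

theory Defs
  imports
    "HOL-Probability.Probability"
    "HOL-Library.Landau_Symbols"
    "Jordan_Normal_Form.DL_Rank"
begin

hide_const (open) Finite_Cartesian_Product.mat

definition frob_norm :: "real mat \<Rightarrow> real" where
  "frob_norm A = sqrt (\<Sum>i<dim_row A. \<Sum>j<dim_col A. (A $$ (i, j))\<^sup>2)"

abbreviation mat_rank :: "real mat \<Rightarrow> nat" where
  "mat_rank A \<equiv> vec_space.rank (dim_row A) A"

(* [A]_k. A minimiser always exists: by Eckart-Young, the singular value decomposition truncated
   to the k largest singular values is one. It need not be unique when singular values coincide,
   but all minimisers have the same error, and only the error is used. *)
definition best_rank_approx :: "nat \<Rightarrow> real mat \<Rightarrow> real mat" where
  "best_rank_approx k A =
     arg_min_on (\<lambda>B. frob_norm (A - B))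
       {B \<in> carrier_mat (dim_row A) (dim_col A). mat_rank B \<le> k}"

(* Projections are idempotents; they are not required to be orthogonal. *)
definition rank_projection :: "nat \<Rightarrow> nat \<Rightarrow> real mat \<Rightarrow> bool" where
  "rank_projection d k P \<longleftrightarrow> P \<in> carrier_mat d d \<and> P * P = P \<and> mat_rank P = k"

definition implicit_mat :: "(real \<Rightarrow> real) \<Rightarrow> real mat \<Rightarrow> real mat \<Rightarrow> real mat" where
  "implicit_mat f A1 A2 = mat (dim_row A1) (dim_col A1) (\<lambda>(i, j). f (A1 $$ (i, j) + A2 $$ (i, j)))"

definition low_rank_solution :: "nat \<Rightarrow> real \<Rightarrow> real mat \<Rightarrow> real mat \<Rightarrow> bool" where
  "low_rank_solution k \<epsilon> A P \<longleftrightarrow>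
     rank_projection (dim_col A) k P \<and>
     (frob_norm (A - A * P))\<^sup>2 \<le> (1 + \<epsilon>) * (frob_norm (A - best_rank_approx k A))\<^sup>2"

(* Deterministic two-party protocol trees. At an inner node one player sends one bit, which may
   depend on that player's input and on the bits exchanged so far. At a leaf one player announces
   the output; it may depend on that player's input, so announcing it costs no communication.
   An output determined by the bits exchanged alone is the case of a constant function. *)
datatype ('x, 'y, 'o) protocol =
    Alice_Output "'x \<Rightarrow> 'o"
  | Bob_Output "'y \<Rightarrow> 'o"
  | Alice_Sends "'x \<Rightarrow> bool" "('x, 'y, 'o) protocol" "('x, 'y, 'o) protocol"
  | Bob_Sends "'y \<Rightarrow> bool" "('x, 'y, 'o) protocol" "('x, 'y, 'o) protocol"

primrec run :: "('x, 'y, 'o) protocol \<Rightarrow> 'x \<Rightarrow> 'y \<Rightarrow> 'o" where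
  "run (Alice_Output g) x y = g x"
| "run (Bob_Output g) x y = g y"
| "run (Alice_Sends s \<pi>0 \<pi>1) x y = (if s x then run \<pi>1 x y else run \<pi>0 x y)"
| "run (Bob_Sends s \<pi>0 \<pi>1) x y = (if s y then run \<pi>1 x y else run \<pi>0 x y)"

primrec bits :: "('x, 'y, 'o) protocol \<Rightarrow> nat" where
  "bits (Alice_Output g) = 0"
| "bits (Bob_Output g) = 0"
| "bits (Alice_Sends s \<pi>0 \<pi>1) = Suc (max (bits \<pi>0) (bits \<pi>1))"
| "bits (Bob_Sends s \<pi>0 \<pi>1) = Suc (max (bits \<pi>0) (bits \<pi>1))"

(* A randomized protocol is a probability distribution M on deterministic protocols: the players
   share their random coins, which subsumes private coins. The measure of a non-measurable set
   is 0, so the bound on the success probability includes measurability of the success event. *)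
definition computes_low_rank ::
  "(real \<Rightarrow> real) \<Rightarrow> nat \<Rightarrow> real \<Rightarrow> real \<Rightarrow> (real mat \<times> real mat) set \<Rightarrow>
   (real mat, real mat, real mat) protocol measure \<Rightarrow> bool" where
  "computes_low_rank f k \<epsilon> q D M \<longleftrightarrow>
     prob_space M \<and>
     (\<forall>(A1, A2) \<in> D.
        measure M {\<pi> \<in> space M. low_rank_solution k \<epsilon> (implicit_mat f A1 A2) (run \<pi> A1 A2)} \<ge> q)"

definition bounded_int_mats :: "nat \<Rightarrow> nat \<Rightarrow> real \<Rightarrow> real mat set" where
  "bounded_int_mats n d L =
     {A \<in> carrier_mat n d. \<forall>i<n. \<forall>j<d. A $$ (i, j) \<in> \<int> \<and> \<bar>A $$ (i, j)\<bar> \<le> L}"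

(* D is the set of inputs on which a protocol has to succeed. On the set of all pairs of real
   matrices no protocol with a bounded number of bits succeeds at all, since inputs of infinite
   precision with A of rank k can require infinitely many different P. Hence D may be any set of
   inputs that contains the integer matrices with entries of O(log ((1 + eps) n d)) bits; the set
   of all pairs of real matrices is one of these. *)
definition admissible_inputs :: "nat \<Rightarrow> nat \<Rightarrow> real \<Rightarrow> (real mat \<times> real mat) set \<Rightarrow> bool" where
  "admissible_inputs n d L D \<longleftrightarrow>
     bounded_int_mats n d L \<times> bounded_int_mats n d L \<subseteq> D \<and>
     D \<subseteq> carrier_mat n d \<times> carrier_mat n d"

end

theory Submission
  imports Defs
begin

unbundle no vec_syntax

text \<open>The hard input has \<open>k - 1\<close> large diagonal entries that are known to both players, and
  one large entry in a random cell of the remaining block. All other entries are bounded, so a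
  rank-\<open>k\<close> projection within the factor \<open>1 + \<epsilon>\<close> of the optimum has to preserve the
  column of the hidden entry and is too small to preserve any other one: it reveals that column.

  In every background cell the pair of integers \<open>(x, y)\<close> held by the players is an end of a
  random edge of the path \<open>(0,0), (0,1), (1,1), (1,2), \<dots>\<close>, and \<open>f\<close> is applied to
  \<open>x - y\<close>, which is \<open>0\<close> or \<open>-1\<close>. The hidden entry adds \<open>B\<close> to \<open>y\<close>. A protocol
  with \<open>t\<close> bits splits the inputs into at most \<open>2 ^ t\<close> rectangles. By the level-one inequality
  the squared Hellinger distances between the transcript distributions at the two ends of an edge
  add up, over the \<open>m\<close> cells, to \<open>O(t)\<close>. Walking along \<open>2 * B\<close> edges costs a factor
  \<open>B\<^sup>2\<close>, and the cut-and-paste property of rectangles carries the closeness of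
  \<open>(x, y)\<close> and \<open>(x + B, y + B)\<close> over to \<open>(x, y + B)\<close>. So, unless \<open>t\<close> is of order
  \<open>m / B\<^sup>2\<close>, the players find the hidden column hardly better than by guessing, that is
  with probability at most about \<open>1 / 2\<close>. Here \<open>B\<close> is of order
  \<open>((1 + \<epsilon>)\<^sup>2 * n * d ^ 4) powr (1 / (2 * p))\<close>.\<close>

section \<open>Low-rank approximation of spiked matrices\<close>

text \<open>Dependence is indexed by column positions rather than by a set of vectors, so that two
  equal columns count as dependent. The condition is then a system of equations in the entries,
  which passes to entrywise limits.\<close>

lemma (in vec_space) rank_le_iff_dependent_cols:
  assumes A: "A \<in> carrier_mat n nc"
  shows "rank A \<le> k \<longleftrightarrow> (\<forall>J\<subseteq>{..<nc}. card J = Suc k \<longrightarrow>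
    (\<exists>y. (\<exists>j\<in>J. y j \<noteq> 0) \<and> (\<forall>i<n. (\<Sum>j\<in>J. y j * A $$ (i, j)) = 0)))"
proof (intro iffI allI impI)
  fix J assume rk: "rank A \<le> k" and J: "J \<subseteq> {..<nc}" and cJ: "card J = Suc k"
  have finJ: "finite J" using J finite_subset by blast
  show "\<exists>y. (\<exists>j\<in>J. y j \<noteq> 0) \<and> (\<forall>i<n. (\<Sum>j\<in>J. y j * A $$ (i, j)) = 0)"
  proof (cases "inj_on (col A) J")
    \<comment> \<open>Two equal columns: their difference is a dependence that the set of columns
      does not see.\<close>
    case False
    then obtain j j' where jj: "j \<in> J" "j' \<in> J" "j \<noteq> j'" "col A j = col A j'"
      by (auto simp: inj_on_def)
    define y :: "nat \<Rightarrow> 'a" where "y l = (if l = j then 1 else if l = j' then -1 else 0)" for l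
    have "(\<Sum>l\<in>J. y l * A $$ (i, l)) = 0" if i: "i < n" for i
    proof -
      have eq: "A $$ (i, j) = A $$ (i, j')"
        using jj J i A by (metis carrier_matD(1) carrier_matD(2) index_col lessThan_iff subset_iff)
      have "(\<Sum>l\<in>J. y l * A $$ (i, l)) = (\<Sum>l\<in>{j, j'}. y l * A $$ (i, l))"
        by (rule sum.mono_neutral_right) (use finJ jj in \<open>auto simp: y_def\<close>)
      also have "\<dots> = 0" using jj eq by (simp add: y_def)
      finally show ?thesis .
    qed
    moreover have "y j \<noteq> 0" by (simp add: y_def)
    ultimately show ?thesis using jj(1) by blast
  next
    case True
    let ?U = "col A ` J"
    have U: "?U \<subseteq> set (cols A)" using J A by (auto simp: cols_def)
    have Uc: "?U \<subseteq> carrier_vec n" using U cols_dim A by blast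
    have "card ?U = Suc k" using True cJ by (simp add: card_image)
    then have "lin_dep ?U" using rank_ge_card_indpt[OF A U] rk by fastforce
    then obtain a v where av: "lincomb a ?U = 0\<^sub>v n" "v \<in> ?U" "a v \<noteq> 0"
      using finite_lin_dep[of ?U] Uc finJ by auto
    have "(\<Sum>j\<in>J. a (col A j) * A $$ (i, j)) = 0" if i: "i < n" for i
    proof -
      have "(\<Sum>j\<in>J. a (col A j) * A $$ (i, j)) = (\<Sum>j\<in>J. a (col A j) * col A j $ i)"
        using J A i by (intro sum.cong) auto
      also have "\<dots> = (\<Sum>x\<in>?U. a x * x $ i)" by (simp add: sum.reindex[OF True])
      also have "\<dots> = lincomb a ?U $ i" using lincomb_index[OF i Uc] by simp
      finally show ?thesis using av i by simp
    qed
    moreover obtain j where "j \<in> J" "a (col A j) \<noteq> 0" using av by blast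
    ultimately show ?thesis by (intro exI[of _ "\<lambda>j. a (col A j)"]) auto
  qed
next
  assume H: "\<forall>J\<subseteq>{..<nc}. card J = Suc k \<longrightarrow>
    (\<exists>y. (\<exists>j\<in>J. y j \<noteq> 0) \<and> (\<forall>i<n. (\<Sum>j\<in>J. y j * A $$ (i, j)) = 0))"
  show "rank A \<le> k"
  proof (rule ccontr)
    assume "\<not> rank A \<le> k"
    \<comment> \<open>The size of a maximal independent set of columns is the rank;
      \<open>k + 1\<close> of its vectors, each given one column position \<open>h u\<close>,
      contradict \<open>H\<close>.\<close>
    obtain S where S: "maximal S (\<lambda>T. T \<subseteq> set (cols A) \<and> lin_indpt T)"
      using maximal_exists_superset[of "set (cols A)" "\<lambda>T. T \<subseteq> set (cols A) \<and> lin_indpt T" "{}"]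
      by (auto simp: lin_dep_def)
    have "card S \<ge> Suc k" using rank_card_indpt[OF A S] \<open>\<not> rank A \<le> k\<close> by simp
    then obtain U where U: "U \<subseteq> S" "card U = Suc k" by (meson obtain_subset_with_card_n)
    have Usub: "U \<subseteq> set (cols A)" and Ul: "lin_indpt U"
      using U S supset_ld_is_ld[of U S] by (auto simp: maximal_def)
    have Uc: "U \<subseteq> carrier_vec n" using Usub cols_dim A by blast
    have "\<forall>u\<in>U. \<exists>j<nc. col A j = u"
      using Usub A by (fastforce simp: cols_def)
    then obtain h where h: "\<And>u. u \<in> U \<Longrightarrow> h u < nc \<and> col A (h u) = u" by metis
    have inj: "inj_on h U" using h by (metis inj_onI)
    have "h ` U \<subseteq> {..<nc}" "card (h ` U) = Suc k" using h inj U by (auto simp: card_image)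
    from H[THEN spec, THEN mp, THEN mp, OF this] obtain y where y: "\<exists>j\<in>h ` U. y j \<noteq> 0" "\<forall>i<n. (\<Sum>j\<in>h ` U. y j * A $$ (i, j)) = 0"
      by (elim exE conjE)
    have "lincomb (\<lambda>u. y (h u)) U = 0\<^sub>v n"
    proof (rule eq_vecI)
      show "dim_vec (lincomb (\<lambda>u. y (h u)) U) = dim_vec (0\<^sub>v n)"
        using Uc lincomb_dim[OF _ Uc] U by (metis card.infinite index_zero_vec(2) nat.distinct(1))
      fix i assume "i < dim_vec (0\<^sub>v n)"
      then have i: "i < n" by simp
      have "lincomb (\<lambda>u. y (h u)) U $ i = (\<Sum>u\<in>U. y (h u) * u $ i)"
        by (rule lincomb_index[OF i Uc])
      also have "\<dots> = (\<Sum>u\<in>U. y (h u) * A $$ (i, h u))"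
        using h A i by (intro sum.cong refl) (metis carrier_matD(1) carrier_matD(2) index_col)
      also have "\<dots> = 0" using y(2) i by (simp add: sum.reindex[OF inj])
      finally show "lincomb (\<lambda>u. y (h u)) U $ i = 0\<^sub>v n $ i" using i by simp
    qed
    moreover obtain u where "u \<in> U" "y (h u) \<noteq> 0" using y(1) by blast
    moreover have "finite U" using U(2) card.infinite by fastforce
    ultimately have "lin_dep U" unfolding lin_dep_def by blast
    then show False using Ul by blast
  qed
qed

text \<open>Bolzano-Weierstrass in finitely many coordinates, applied below to coefficient vectors
  and to matrix entries.\<close>

lemma finite_pointwise_subsequence:
  fixes g :: "nat \<Rightarrow> 'b \<Rightarrow> real"
  assumes "finite X" and "\<And>n x. x \<in> X \<Longrightarrow> \<bar>g n x\<bar> \<le> C"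
  shows "\<exists>l r. strict_mono (r :: nat \<Rightarrow> nat) \<and> (\<forall>x\<in>X. (\<lambda>n. g (r n) x) \<longlonglongrightarrow> l x)"
proof -
  have "bounded ((\<lambda>h. h x) ` range g)" if "x \<in> X" for x
    unfolding bounded_iff using assms(2)[OF that] by auto
  then have "\<forall>Y\<subseteq>X. \<exists>l. \<exists>r::nat\<Rightarrow>nat. strict_mono r \<and>
      (\<forall>e>0. \<forall>\<^sub>F n in sequentially. \<forall>x\<in>Y. dist (g (r n) x) (l x) < e)"
    by (rule compact_lemma_general[of X "\<lambda>h x. h x" g "\<lambda>h. h", OF assms(1)]) auto
  then obtain l r where lr: "strict_mono (r :: nat \<Rightarrow> nat)"
    "\<forall>e>0. \<forall>\<^sub>F n in sequentially. \<forall>x\<in>X. dist (g (r n) x) (l x) < e" by blast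
  have "(\<lambda>n. g (r n) x) \<longlonglongrightarrow> l x" if "x \<in> X" for x
    unfolding tendsto_iff
  proof (intro allI impI)
    fix e :: real assume "e > 0"
    then show "\<forall>\<^sub>F n in sequentially. dist (g (r n) x) (l x) < e"
      using lr(2) that by (auto elim!: eventually_mono)
  qed
  with lr(1) show ?thesis by blast
qed

text \<open>Each approximating matrix has a dependence among the columns of \<open>J\<close>, which
  can be scaled to absolute sum 1. By compactness a subsequence of the coefficients converges; the
  normalisation survives, so the limit is again nontrivial.\<close>

lemma rank_le_limit:
  fixes Bs :: "nat \<Rightarrow> real mat"
  assumes Bs: "\<And>N. Bs N \<in> carrier_mat n d" "\<And>N. vec_space.rank n (Bs N) \<le> k"
    and B: "B \<in> carrier_mat n d"
    and lim: "\<And>i j. i < n \<Longrightarrow> j < d \<Longrightarrow> (\<lambda>N. Bs N $$ (i, j)) \<longlonglongrightarrow> B $$ (i, j)"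
  shows "vec_space.rank n B \<le> k"
  unfolding vec_space.rank_le_iff_dependent_cols[OF B]
proof (intro allI impI)
  fix J assume J: "J \<subseteq> {..<d}" "card J = Suc k"
  have fin: "finite J" using J(1) finite_subset by blast
  have ex: "\<exists>y. (\<Sum>j\<in>J. \<bar>y j\<bar>) = 1 \<and> (\<forall>i<n. (\<Sum>j\<in>J. y j * Bs N $$ (i, j)) = 0)" for N
  proof -
    obtain z where z: "\<exists>j\<in>J. z j \<noteq> 0" "\<forall>i<n. (\<Sum>j\<in>J. z j * Bs N $$ (i, j)) = 0"
      using Bs(2)[of N, unfolded vec_space.rank_le_iff_dependent_cols[OF Bs(1)], THEN spec, THEN mp, THEN mp, OF J]
      by (elim exE conjE)
    define w where "w = (\<Sum>j\<in>J. \<bar>z j\<bar>)"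
    have "w \<noteq> 0" using z(1) fin by (auto simp: w_def sum_nonneg_eq_0_iff)
    moreover have "w \<ge> 0" by (simp add: w_def sum_nonneg)
    ultimately have "w > 0" by simp
    have "(\<Sum>j\<in>J. \<bar>z j / w\<bar>) = w / w"
      using \<open>w > 0\<close> by (simp add: w_def[symmetric] sum_divide_distrib[symmetric])
    moreover have "(\<Sum>j\<in>J. z j / w * Bs N $$ (i, j)) = 0" if "i < n" for i
      using z(2) that by (simp add: sum_divide_distrib[symmetric])
    ultimately show ?thesis using \<open>w > 0\<close> by (intro exI[of _ "\<lambda>j. z j / w"]) simp
  qed
  obtain y where y: "\<And>N. (\<Sum>j\<in>J. \<bar>y N j\<bar>) = 1"
    "\<And>N i. i < n \<Longrightarrow> (\<Sum>j\<in>J. y N j * Bs N $$ (i, j)) = 0"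
    using choice[of "\<lambda>N y. (\<Sum>j\<in>J. \<bar>y j\<bar>) = 1 \<and> (\<forall>i<n. (\<Sum>j\<in>J. y j * Bs N $$ (i, j)) = 0)"] ex by blast
  have "\<bar>y N j\<bar> \<le> 1" if "j \<in> J" for N j
    using y(1)[of N] member_le_sum[OF that, of "\<lambda>j. \<bar>y N j\<bar>"] fin by simp
  from finite_pointwise_subsequence[where g = y, OF fin this] obtain l r where r: "strict_mono (r :: nat \<Rightarrow> nat)"
    and l: "\<And>j. j \<in> J \<Longrightarrow> (\<lambda>N. y (r N) j) \<longlonglongrightarrow> l j"
    by blast
  have "(\<lambda>N. \<Sum>j\<in>J. \<bar>y (r N) j\<bar>) \<longlonglongrightarrow> (\<Sum>j\<in>J. \<bar>l j\<bar>)"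
    by (intro tendsto_intros l)
  then have "(\<Sum>j\<in>J. \<bar>l j\<bar>) = 1" using y(1) by (simp add: LIMSEQ_const_iff)
  then have "\<exists>j\<in>J. l j \<noteq> 0" by (metis abs_zero sum.neutral zero_neq_one)
  moreover have "(\<Sum>j\<in>J. l j * B $$ (i, j)) = 0" if "i < n" for i
  proof -
    have "(\<lambda>N. Bs (r N) $$ (i, j)) \<longlonglongrightarrow> B $$ (i, j)" if "j \<in> J" for j
      using LIMSEQ_subseq_LIMSEQ[OF lim r, of i j] J(1) that \<open>i < n\<close> by (auto simp: o_def)
    then have "(\<lambda>N. \<Sum>j\<in>J. y (r N) j * Bs (r N) $$ (i, j)) \<longlonglongrightarrow> (\<Sum>j\<in>J. l j * B $$ (i, j))"
      by (intro tendsto_intros l)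
    then show ?thesis using y(2)[OF that] by (simp add: LIMSEQ_const_iff)
  qed
  ultimately show "\<exists>y. (\<exists>j\<in>J. y j \<noteq> 0) \<and> (\<forall>i<n. (\<Sum>j\<in>J. y j * B $$ (i, j)) = 0)"
    by (intro exI[of _ l]) auto
qed

section \<open>Best approximation in the Frobenius norm\<close>

lemma frob_norm_nonneg: "0 \<le> frob_norm A"
  by (simp add: frob_norm_def sum_nonneg)

lemma frob_norm_power2: "(frob_norm A)\<^sup>2 = (\<Sum>i<dim_row A. \<Sum>j<dim_col A. (A $$ (i, j))\<^sup>2)"
  by (simp add: frob_norm_def sum_nonneg)

lemma abs_index_le_frob_norm:
  assumes "i < dim_row A" "j < dim_col A"
  shows "\<bar>A $$ (i, j)\<bar> \<le> frob_norm A"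
proof -
  have "(A $$ (i, j))\<^sup>2 \<le> (\<Sum>j<dim_col A. (A $$ (i, j))\<^sup>2)"
    using assms by (intro member_le_sum[of j _ "\<lambda>j. (A $$ (i, j))\<^sup>2"]) auto
  also have "\<dots> \<le> (\<Sum>i<dim_row A. \<Sum>j<dim_col A. (A $$ (i, j))\<^sup>2)"
    using assms by (intro member_le_sum[of i _ "\<lambda>i. \<Sum>j<dim_col A. (A $$ (i, j))\<^sup>2"]) (auto intro: sum_nonneg)
  finally have "(A $$ (i, j))\<^sup>2 \<le> (frob_norm A)\<^sup>2" by (simp add: frob_norm_power2)
  then show ?thesis using frob_norm_nonneg abs_le_square_iff[of "A $$ (i, j)" "frob_norm A"] by simp
qed

text \<open>\<open>best_rank_approx\<close> is a choice among minimisers, so its minimality requires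
  that one exists. A minimising sequence has bounded entries, and the limit of a subsequence still
  has rank at most \<open>k\<close>.\<close>

lemma frob_norm_best_rank_approx_le:
  assumes A: "A \<in> carrier_mat n d" and B: "B \<in> carrier_mat n d" "vec_space.rank n B \<le> k"
  shows "frob_norm (A - best_rank_approx k A) \<le> frob_norm (A - B)"
proof -
  define S where "S = {B :: real mat. B \<in> carrier_mat n d \<and> vec_space.rank n B \<le> k}"
  define F where "F B = frob_norm (A - B)" for B
  have S_eq: "{B \<in> carrier_mat (dim_row A) (dim_col A). mat_rank B \<le> k} = S"
    using A by (auto simp: S_def)
  have "B \<in> S" using B by (simp add: S_def)
  define m where "m = Inf (F ` S)"
  have bdd: "bdd_below (F ` S)" by (rule bdd_belowI[of _ 0]) (auto simp: F_def frob_norm_nonneg)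
  have mle: "m \<le> F X" if "X \<in> S" for X
    unfolding m_def using bdd that by (simp add: cINF_lower)
  have ex: "\<exists>X\<in>S. F X < m + 1 / real (Suc N)" for N
    using cInf_lessD[of "F ` S" "m + 1 / real (Suc N)"] \<open>B \<in> S\<close> by (auto simp: m_def)
  obtain Bs where Bs: "\<And>N. Bs N \<in> S" "\<And>N. F (Bs N) < m + 1 / real (Suc N)"
    using ex by metis
  have Bc: "Bs N \<in> carrier_mat n d" "vec_space.rank n (Bs N) \<le> k" for N
    using Bs(1) by (auto simp: S_def)
  define X where "X = {..<n} \<times> {..<d}"
  have bound: "\<bar>Bs N $$ x\<bar> \<le> frob_norm A + m + 1" if "x \<in> X" for N x
  proof -
    obtain i j where x: "x = (i, j)" "i < n" "j < d" using \<open>x \<in> X\<close> by (auto simp: X_def)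
    have "F (Bs N) \<le> m + 1" using Bs(2)[of N] by (smt (verit) divide_le_eq_1 of_nat_0_less_iff of_nat_Suc of_nat_0_le_iff)
    moreover have "\<bar>(A - Bs N) $$ (i, j)\<bar> \<le> F (Bs N)"
      unfolding F_def using A Bc(1)[of N] x by (intro abs_index_le_frob_norm) auto
    moreover have "(A - Bs N) $$ (i, j) = A $$ (i, j) - Bs N $$ (i, j)" using Bc(1)[of N] x by simp
    moreover have "\<bar>A $$ (i, j)\<bar> \<le> frob_norm A" using A x by (intro abs_index_le_frob_norm) auto
    ultimately show ?thesis unfolding x by linarith
  qed
  have "finite X" by (simp add: X_def)
  from finite_pointwise_subsequence[where g = "\<lambda>N x. Bs N $$ x", OF this bound] obtain l r where r: "strict_mono (r :: nat \<Rightarrow> nat)"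
    and l: "\<And>x. x \<in> X \<Longrightarrow> (\<lambda>N. Bs (r N) $$ x) \<longlonglongrightarrow> l x"
    by blast
  define L where "L = mat n d l"
  have L: "L \<in> carrier_mat n d" by (simp add: L_def)
  have lim: "(\<lambda>N. Bs (r N) $$ (i, j)) \<longlonglongrightarrow> L $$ (i, j)" if "i < n" "j < d" for i j
    using l[of "(i, j)"] that by (simp add: X_def L_def)
  have "L \<in> S" using rank_le_limit[OF Bc(1) Bc(2) L lim] L by (simp add: S_def)
  have F_eq: "F X = sqrt (\<Sum>i<n. \<Sum>j<d. (A $$ (i, j) - X $$ (i, j))\<^sup>2)" if "X \<in> carrier_mat n d" for X
    using A that by (simp add: F_def frob_norm_def)
  have "(\<lambda>N. F (Bs (r N))) \<longlonglongrightarrow> F L"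
    unfolding F_eq[OF Bc(1)] F_eq[OF L] by (intro tendsto_intros lim) auto
  moreover have "(\<lambda>N. m + 1 / real (Suc (r N))) \<longlonglongrightarrow> m + 0"
    using LIMSEQ_subseq_LIMSEQ[OF LIMSEQ_inverse_real_of_nat r]
    by (intro tendsto_intros) (simp add: o_def inverse_eq_divide)
  ultimately have "F L \<le> m"
    using Bs(2) by (intro LIMSEQ_le[of "\<lambda>N. F (Bs (r N))" _ "\<lambda>N. m + 1 / real (Suc (r N))"]) (auto intro!: less_imp_le)
  then have "is_arg_min F (\<lambda>X. X \<in> S) L"
    using \<open>L \<in> S\<close> mle by (force simp: is_arg_min_linorder)
  then have "is_arg_min F (\<lambda>X. X \<in> S) (best_rank_approx k A)"
    unfolding best_rank_approx_def S_eq arg_min_on_def arg_min_def F_def[symmetric] by (rule someI)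
  then show ?thesis using \<open>B \<in> S\<close> by (simp add: is_arg_min_linorder F_def)
qed

section \<open>Matrices with isolated large entries\<close>

text \<open>\<open>C\<close> holds the columns with a spike and \<open>\<rho>\<close> the row of the
  spike in each. As \<open>\<rho>\<close> is injective on \<open>C\<close>, no row and no column
  contains two of them.\<close>

definition spiked :: "nat \<Rightarrow> nat \<Rightarrow> real \<Rightarrow> real \<Rightarrow> nat set \<Rightarrow> (nat \<Rightarrow> nat) \<Rightarrow> real mat \<Rightarrow> bool" where
  "spiked n d H M C \<rho> A \<longleftrightarrow> A \<in> carrier_mat n d \<and> C \<subseteq> {..<d} \<and> inj_on \<rho> C \<and> \<rho> ` C \<subseteq> {..<n} \<and>
     (\<forall>i<n. \<forall>j<d. if j \<in> C \<and> i = \<rho> j then H \<le> \<bar>A $$ (i, j)\<bar> else \<bar>A $$ (i, j)\<bar> \<le> M)"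

text \<open>Keeping the spikes and zeroing the rest gives a competitor: its error is the background,
  and it has at most \<open>k\<close> nonzero columns.\<close>

lemma spiked_best_rank_approx:
  assumes A: "spiked n d H M C \<rho> A" and C: "card C \<le> k" and M: "M \<ge> 0"
  shows "(frob_norm (A - best_rank_approx k A))\<^sup>2 \<le> real n * real d * M\<^sup>2"
proof -
  have Ac: "A \<in> carrier_mat n d" using A by (simp add: spiked_def)
  define B where "B = mat n d (\<lambda>(i, j). if j \<in> C \<and> i = \<rho> j then A $$ (i, j) else 0)"
  have Bc: "B \<in> carrier_mat n d" by (simp add: B_def)
  have finC: "finite C" using A finite_subset by (auto simp: spiked_def)
  have rk: "vec_space.rank n B \<le> k"
    unfolding vec_space.rank_le_iff_dependent_cols[OF Bc]
  proof (intro allI impI)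
    fix J assume J: "J \<subseteq> {..<d}" "card J = Suc k"
    have "\<not> J \<subseteq> C" using card_mono[OF finC, of J] J C by auto
    then obtain l where l: "l \<in> J" "l \<notin> C" by blast
    show "\<exists>y. (\<exists>j\<in>J. y j \<noteq> 0) \<and> (\<forall>i<n. (\<Sum>j\<in>J. y j * B $$ (i, j)) = 0)"
      using l J(1) by (intro exI[of _ "\<lambda>j. if j = l then 1 else 0"])
        (auto simp: B_def intro!: sum.neutral)
  qed
  have "frob_norm (A - best_rank_approx k A) \<le> frob_norm (A - B)"
    by (rule frob_norm_best_rank_approx_le[OF Ac Bc rk])
  then have "(frob_norm (A - best_rank_approx k A))\<^sup>2 \<le> (frob_norm (A - B))\<^sup>2"
    by (intro power_mono frob_norm_nonneg)
  also have "\<dots> = (\<Sum>i<n. \<Sum>j<d. ((A - B) $$ (i, j))\<^sup>2)"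
    using Ac Bc by (simp add: frob_norm_power2)
  also have "\<dots> \<le> (\<Sum>i<n. \<Sum>j<d. M\<^sup>2)"
  proof (intro sum_mono)
    fix i j assume "i \<in> {..<n}" "j \<in> {..<d}"
    then have ij: "i < n" "j < d" by auto
    then have "\<bar>(A - B) $$ (i, j)\<bar> \<le> M"
      using A M Bc by (auto simp: spiked_def B_def)
    then show "((A - B) $$ (i, j))\<^sup>2 \<le> M\<^sup>2" by (metis abs_ge_zero power2_abs power_mono)
  qed
  also have "\<dots> = real n * real d * M\<^sup>2" by simp
  finally show ?thesis .
qed

text \<open>A coefficient vector supported on \<open>J\<close> and annihilated by \<open>P\<close> has the same product with a
  row of \<open>A\<close> as with the corresponding row of \<open>A - A * P\<close>; only the latter is small.\<close>
lemma spike_le_of_dependent_cols: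
  assumes A: "spiked n d H M C \<rho> A" and C: "card C \<le> k" and M: "M \<ge> 0" and \<epsilon>: "\<epsilon> \<ge> 0"
    and P: "low_rank_solution k \<epsilon> A P"
    and J: "J \<subseteq> {..<d}" "j \<in> J" "j \<in> C"
    and y: "\<And>i. i < d \<Longrightarrow> (\<Sum>l\<in>J. y l * P $$ (i, l)) = 0" "\<And>l. l \<in> J \<Longrightarrow> \<bar>y l\<bar> \<le> \<bar>y j\<bar>" "y j \<noteq> 0"
  shows "H \<le> real (card J) * (sqrt ((1 + \<epsilon>) * real n * real d) * M + M)"
proof -
  have Ac: "A \<in> carrier_mat n d" using A by (simp add: spiked_def)
  have Pc: "P \<in> carrier_mat d d" using P Ac by (simp add: low_rank_solution_def rank_projection_def)
  have finJ: "finite J" using J(1) finite_subset by blast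
  define r where "r = \<rho> j"
  define R where "R = A - A * P"
  \<comment> \<open>\<open>E\<close> bounds the Frobenius norm of the residual \<open>R\<close>,
    because the optimum is at most the norm of a background of size \<open>M\<close>.\<close>
  define E where "E = sqrt ((1 + \<epsilon>) * real n * real d) * M"
  have E0: "E \<ge> 0" using M \<epsilon> by (simp add: E_def)
  have rj: "r < n" "j < d" using A J by (auto simp: spiked_def r_def)
  have Rc: "R \<in> carrier_mat n d" using Ac Pc unfolding R_def by (metis minus_carrier_mat mult_carrier_mat)
  have "(frob_norm R)\<^sup>2 \<le> (1 + \<epsilon>) * (frob_norm (A - best_rank_approx k A))\<^sup>2"
    using P by (simp add: low_rank_solution_def R_def)
  also have "\<dots> \<le> (1 + \<epsilon>) * (real n * real d * M\<^sup>2)"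
    using spiked_best_rank_approx[OF A C M] \<epsilon> by (intro mult_left_mono) auto
  also have "\<dots> = E\<^sup>2" using \<epsilon> by (simp add: E_def power_mult_distrib)
  finally have "frob_norm R \<le> E" using E0 by (rule power2_le_imp_le)
  then have R: "\<bar>R $$ (r, l)\<bar> \<le> E" if "l \<in> J" for l
    using abs_index_le_frob_norm[of r R l] Rc rj that J(1) by fastforce
  have "(\<Sum>l\<in>J. y l * R $$ (r, l)) = (\<Sum>l\<in>J. y l * A $$ (r, l)) - (\<Sum>l\<in>J. y l * (\<Sum>i<d. A $$ (r, i) * P $$ (i, l)))"
    unfolding sum_subtractf[symmetric]
  proof (rule sum.cong[OF refl])
    fix l assume "l \<in> J"
    then have l: "l < d" using J(1) by auto
    have "(A * P) $$ (r, l) = (\<Sum>i<d. A $$ (r, i) * P $$ (i, l))"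
      using Ac Pc rj l by (simp add: scalar_prod_def atLeast0LessThan)
    then have "R $$ (r, l) = A $$ (r, l) - (\<Sum>i<d. A $$ (r, i) * P $$ (i, l))"
      unfolding R_def using Ac Pc rj l by simp
    then show "y l * R $$ (r, l) = y l * A $$ (r, l) - y l * (\<Sum>i<d. A $$ (r, i) * P $$ (i, l))"
      by (simp add: right_diff_distrib)
  qed
  also have "(\<Sum>l\<in>J. y l * (\<Sum>i<d. A $$ (r, i) * P $$ (i, l)))
      = (\<Sum>i<d. A $$ (r, i) * (\<Sum>l\<in>J. y l * P $$ (i, l)))"
    unfolding sum_distrib_left by (subst sum.swap) (simp add: mult.left_commute)
  also have "\<dots> = 0" using y(1) by simp
  finally have eq: "(\<Sum>l\<in>J. y l * R $$ (r, l)) = y j * A $$ (r, j) + (\<Sum>l\<in>J - {j}. y l * A $$ (r, l))"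
    using sum.remove[OF finJ J(2), of "\<lambda>l. y l * A $$ (r, l)"] by simp
  have b1: "\<bar>\<Sum>l\<in>J. y l * R $$ (r, l)\<bar> \<le> real (card J) * (\<bar>y j\<bar> * E)"
  proof -
    have "\<bar>\<Sum>l\<in>J. y l * R $$ (r, l)\<bar> \<le> (\<Sum>l\<in>J. \<bar>y l * R $$ (r, l)\<bar>)" by (rule sum_abs)
    also have "\<dots> \<le> (\<Sum>l\<in>J. \<bar>y j\<bar> * E)"
      unfolding abs_mult using y(2) R E0 by (intro sum_mono mult_mono) auto
    finally show ?thesis by simp
  qed
  have b2: "\<bar>\<Sum>l\<in>J - {j}. y l * A $$ (r, l)\<bar> \<le> real (card J) * (\<bar>y j\<bar> * M)"
  proof -
    have "\<bar>\<Sum>l\<in>J - {j}. y l * A $$ (r, l)\<bar> \<le> (\<Sum>l\<in>J - {j}. \<bar>y l * A $$ (r, l)\<bar>)" by (rule sum_abs)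
    also have "\<dots> \<le> (\<Sum>l\<in>J - {j}. \<bar>y j\<bar> * M)"
    proof (rule sum_mono)
      fix l assume l: "l \<in> J - {j}"
      \<comment> \<open>Injectivity of \<open>\<rho>\<close> leaves only background entries in the
        rest of row \<open>r\<close>.\<close>
      then have "\<not> (l \<in> C \<and> r = \<rho> l)" using A J(3) by (auto simp: spiked_def r_def inj_on_def)
      moreover have "l < d" using l J(1) by auto
      ultimately have "\<bar>A $$ (r, l)\<bar> \<le> M" using A rj(1) unfolding spiked_def by metis
      then show "\<bar>y l * A $$ (r, l)\<bar> \<le> \<bar>y j\<bar> * M"
        unfolding abs_mult using y(2) l by (intro mult_mono) auto
    qed
    also have "\<dots> \<le> (\<Sum>l\<in>J. \<bar>y j\<bar> * M)" using M finJ by (intro sum_mono2) auto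
    finally show ?thesis by simp
  qed
  have "\<bar>y j\<bar> * H \<le> \<bar>y j\<bar> * \<bar>A $$ (r, j)\<bar>"
    using A rj J(3) by (intro mult_left_mono) (auto simp: spiked_def r_def)
  also have "\<dots> = \<bar>y j * A $$ (r, j)\<bar>" by (simp add: abs_mult)
  also have "\<dots> \<le> real (card J) * (\<bar>y j\<bar> * E) + real (card J) * (\<bar>y j\<bar> * M)"
    using eq b1 b2 by linarith
  also have "\<dots> = \<bar>y j\<bar> * (real (card J) * (E + M))" by (simp add: algebra_simps)
  finally show ?thesis using y(3) by (simp add: E_def)
qed

text \<open>If \<open>C\<close> and \<open>C'\<close> differed, \<open>C\<close> with one more
  column \<open>c\<close> of \<open>C'\<close> would be \<open>k + 1\<close> columns, which are
  dependent in \<open>P\<close>. The largest coefficient of the dependence sits at a spike column of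
  \<open>A\<close> or of \<open>A'\<close>, and that spike would be too small. Hence
  \<open>P\<close> determines the spike columns.\<close>

lemma spiked_columns_unique:
  assumes A: "spiked n d H M C \<rho> A" "low_rank_solution k \<epsilon> A P" "card C = k"
    and A': "spiked n d H M C' \<rho>' A'" "low_rank_solution k \<epsilon> A' P" "card C' = k"
    and M: "M \<ge> 0" and \<epsilon>: "\<epsilon> \<ge> 0"
    and H: "H > real (Suc k) * (sqrt ((1 + \<epsilon>) * real n * real d) * M + M)"
  shows "C = C'"
proof (rule ccontr)
  assume "C \<noteq> C'"
  have fin: "finite C" "finite C'" and sub: "C \<union> C' \<subseteq> {..<d}"
    using A(1) A'(1) finite_subset[of _ "{..<d}"] by (auto simp: spiked_def)
  have "C' - C \<noteq> {}" using \<open>C \<noteq> C'\<close> card_subset_eq[OF fin(1), of C'] A(3) A'(3) by auto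
  then obtain c where c: "c \<in> C'" "c \<notin> C" by blast
  define J where "J = insert c C"
  have J: "J \<subseteq> {..<d}" "card J = Suc k" "finite J" using c sub fin A(3) by (auto simp: J_def)
  have Pc: "P \<in> carrier_mat d d" "vec_space.rank d P \<le> k"
    using A(1,2) by (auto simp: low_rank_solution_def rank_projection_def spiked_def)
  from Pc(2)[unfolded vec_space.rank_le_iff_dependent_cols[OF Pc(1)], THEN spec, THEN mp, THEN mp, OF J(1,2)]
  obtain y where y: "\<exists>j\<in>J. y j \<noteq> 0" "\<forall>i<d. (\<Sum>j\<in>J. y j * P $$ (i, j)) = 0"
    by (elim exE conjE)
  have "Max ((\<lambda>l. \<bar>y l\<bar>) ` J) \<in> (\<lambda>l. \<bar>y l\<bar>) ` J" using J(3) y(1) by (intro Max_in) auto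
  then obtain j where j: "j \<in> J" "Max ((\<lambda>l. \<bar>y l\<bar>) ` J) = \<bar>y j\<bar>" by blast
  have jmax: "\<bar>y l\<bar> \<le> \<bar>y j\<bar>" if "l \<in> J" for l
    unfolding j(2)[symmetric] using J(3) that by (intro Max_ge) auto
  have yj: "y j \<noteq> 0" using y(1) jmax by force
  have "j \<in> C \<or> j \<in> C'" using j(1) c by (auto simp: J_def)
  then have "H \<le> real (card J) * (sqrt ((1 + \<epsilon>) * real n * real d) * M + M)"
    using spike_le_of_dependent_cols[where y = y, OF A(1) _ M \<epsilon> A(2) J(1) j(1) _ _ jmax yj]
      spike_le_of_dependent_cols[where y = y, OF A'(1) _ M \<epsilon> A'(2) J(1) j(1) _ _ jmax yj] y(2) A(3) A'(3) by auto
  then show False using H J(2) by simp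
qed

section \<open>Averages and the level-one inequality\<close>

text \<open>Expectation under the uniform distribution. The combinatorial part works with finite
  averages only; measure theory enters through the random coins of the protocol.\<close>

definition avg :: "'a set \<Rightarrow> ('a \<Rightarrow> real) \<Rightarrow> real" where
  "avg A F = (\<Sum>a\<in>A. F a) / real (card A)"

lemma avg_add: "avg A (\<lambda>a. F a + G a) = avg A F + avg A G"
  by (simp add: avg_def sum.distrib add_divide_distrib)

lemma avg_cmult: "avg A (\<lambda>a. c * F a) = c * avg A F"
  by (simp add: avg_def sum_distrib_left)

lemma avg_cmult_right: "avg A (\<lambda>a. F a * c) = avg A F * c"
  by (simp add: avg_def sum_distrib_right)

lemma avg_const: "finite A \<Longrightarrow> A \<noteq> {} \<Longrightarrow> avg A (\<lambda>a. c) = c"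
  by (simp add: avg_def)

lemma avg_mono: "(\<And>a. a \<in> A \<Longrightarrow> F a \<le> G a) \<Longrightarrow> avg A F \<le> avg A G"
  by (simp add: avg_def sum_mono divide_right_mono)

lemma avg_nonneg: "(\<And>a. a \<in> A \<Longrightarrow> 0 \<le> F a) \<Longrightarrow> 0 \<le> avg A F"
  by (simp add: avg_def sum_nonneg)

lemma avg_cong: "(\<And>a. a \<in> A \<Longrightarrow> F a = G a) \<Longrightarrow> avg A F = avg A G"
  by (simp add: avg_def)

lemma avg_sum: "avg A (\<lambda>a. \<Sum>b\<in>B. F a b) = (\<Sum>b\<in>B. avg A (\<lambda>a. F a b))"
  unfolding avg_def sum_divide_distrib[symmetric] by (subst sum.swap) (rule refl)

lemma avg_swap: "avg A (\<lambda>a. avg B (F a)) = avg B (\<lambda>b. avg A (\<lambda>a. F a b))"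
  unfolding avg_def sum_divide_distrib[symmetric]
  by (subst sum.swap) (simp add: mult.commute)

lemma avg_le_1: "(\<And>a. a \<in> A \<Longrightarrow> F a \<le> 1) \<Longrightarrow> avg A F \<le> 1"
  by (rule order_trans[OF avg_mono[of A F "\<lambda>_. 1"]]) (auto simp: avg_def)

lemma avg_mult_avg: "avg A F * avg B G = avg A (\<lambda>a. avg B (\<lambda>b. F a * G b))"
  by (simp add: avg_cmult avg_cmult_right)

text \<open>The coordinates of a uniform point of a product are independent, so coordinate
  \<open>i\<close> can be redrawn without changing the distribution.\<close>

lemma avg_PiE_resample:
  assumes I: "finite I" "i \<in> I" and V: "finite (V i)" "V i \<noteq> {}"
  shows "avg (PiE I V) F = avg (PiE I V) (\<lambda>b. avg (V i) (\<lambda>v. F (b(i := v))))"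
proof -
  define I' where "I' = I - {i}"
  have Ieq: "I = insert i I'" "i \<notin> I'" using I(2) by (auto simp: I'_def)
  have fub: "(\<Sum>b\<in>PiE I V. G b) = (\<Sum>v\<in>V i. \<Sum>g\<in>PiE I' V. G (g(i := v)))" for G :: "_ \<Rightarrow> real"
  proof -
    have "inj_on (\<lambda>(v, g). g(i := v)) (V i \<times> PiE I' V)"
      using inj_combinator[OF Ieq(2), of V] by (simp add: Ieq)
    then show ?thesis
      unfolding Ieq(1) PiE_insert_eq
      by (subst sum.reindex) (auto simp: sum.cartesian_product split_def)
  qed
  have "(\<Sum>b\<in>PiE I V. \<Sum>v\<in>V i. F (b(i := v))) = real (card (V i)) * (\<Sum>b\<in>PiE I V. F b)"
    unfolding fub by (simp add: sum.swap[of _ "PiE I' V" "V i"])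
  then show ?thesis
    using V by (simp add: avg_def sum_divide_distrib[symmetric])
qed

text \<open>The derivative of \<open>t\<^sup>2 / 2 - ln (cosh t)\<close> is
  \<open>t - tanh t\<close>, whose own derivative is \<open>(tanh t)\<^sup>2\<close>. This is the
  sub-Gaussian bound for a random sign.\<close>

lemma cosh_le_exp_half_square: "cosh x \<le> exp (x\<^sup>2 / 2)" for x :: real
proof -
  have tanh_le: "tanh t \<le> t" if "t \<ge> 0" for t :: real
  proof -
    have "0 - tanh 0 \<le> t - tanh t"
    proof (rule DERIV_nonneg_imp_nondecreasing[OF that])
      fix s :: real
      have "((\<lambda>t. t - tanh t) has_real_derivative 1 - (1 - (tanh s)\<^sup>2)) (at s)"
        by (auto intro!: derivative_eq_intros)
      then show "\<exists>y. ((\<lambda>t. t - tanh t) has_real_derivative y) (at s) \<and> 0 \<le> y" by force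
    qed
    then show ?thesis by simp
  qed
  have "ln (cosh t) \<le> t\<^sup>2 / 2" if "t \<ge> 0" for t :: real
  proof -
    have "0\<^sup>2 / 2 - ln (cosh 0) \<le> t\<^sup>2 / 2 - ln (cosh t)"
    proof (rule DERIV_nonneg_imp_nondecreasing[OF that])
      fix s :: real assume "0 \<le> s"
      have "((\<lambda>t. t\<^sup>2 / 2 - ln (cosh t)) has_real_derivative s - tanh s) (at s)"
        by (auto intro!: derivative_eq_intros simp: tanh_def field_simps)
      then show "\<exists>y. ((\<lambda>t. t\<^sup>2 / 2 - ln (cosh t)) has_real_derivative y) (at s) \<and> 0 \<le> y"
        using tanh_le[OF \<open>0 \<le> s\<close>] by force
    qed
    then show ?thesis by simp
  qed
  from this[of x] this[of "- x"] have "ln (cosh x) \<le> x\<^sup>2 / 2" by (cases "x \<ge> 0") auto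
  then have "exp (ln (cosh x)) \<le> exp (x\<^sup>2 / 2)" by (simp only: exp_le_cancel_iff)
  then show ?thesis by simp
qed

section \<open>Correlations with single bits on the cube\<close>

abbreviation cube :: "'i set \<Rightarrow> ('i \<Rightarrow> nat) set" where
  "cube I \<equiv> PiE I (\<lambda>_. {0, 1})"

abbreviation bit_sign :: "nat \<Rightarrow> real" where
  "bit_sign b \<equiv> (if b = 0 then - 1 else 1)"

lemma finite_cube: "finite I \<Longrightarrow> finite (cube I)"
  by (intro finite_PiE) auto

lemma cube_nonempty: "cube I \<noteq> {}"
  by (simp add: PiE_eq_empty_iff)

lemma card_cube: "finite I \<Longrightarrow> card (cube I) = 2 ^ card I"
  by (simp add: card_PiE numeral_2_eq_2)

text \<open>The proof compares the exponential moment of the linear form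
  \<open>\<Sum> v i * bit_sign (b i)\<close> over the cube with the contribution of \<open>S\<close> alone.\<close>
lemma level_one_inequality:
  assumes I: "finite I" and S: "\<And>b. b \<in> cube I \<Longrightarrow> 0 \<le> S b \<and> S b \<le> 1"
    and p: "p = avg (cube I) S" "p > 0"
  shows "(\<Sum>i\<in>I. (avg (cube I) (\<lambda>b. S b * bit_sign (b i)))\<^sup>2) \<le> 2 * p\<^sup>2 * (- ln p)"
proof -
  define g where "g i = avg (cube I) (\<lambda>b. S b * bit_sign (b i))" for i
  \<comment> \<open>\<open>v i\<close> is the mean of the sign of bit \<open>i\<close> under the
    density \<open>S / p\<close>, so that \<open>W\<close> is the mean of \<open>Z\<close> under
    this density.\<close>
  define v where "v i = g i / p" for i
  define W where "W = (\<Sum>i\<in>I. (v i)\<^sup>2)"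
  define Z where "Z b = (\<Sum>i\<in>I. v i * bit_sign (b i))" for b :: "'a \<Rightarrow> nat"
  have SZ: "avg (cube I) (\<lambda>b. S b * Z b) = p * W"
  proof -
    have "avg (cube I) (\<lambda>b. S b * Z b) = (\<Sum>i\<in>I. avg (cube I) (\<lambda>b. v i * (S b * bit_sign (b i))))"
      unfolding Z_def sum_distrib_left avg_sum[symmetric] by (simp add: mult.left_commute)
    also have "\<dots> = (\<Sum>i\<in>I. v i * g i)" by (simp only: avg_cmult g_def)
    also have "\<dots> = p * W"
      unfolding W_def sum_distrib_left using p(2) by (intro sum.cong) (auto simp: v_def power2_eq_square)
    finally show ?thesis .
  qed
  \<comment> \<open>The tangent to \<open>exp\<close> at \<open>W\<close> is averaged with weight
    \<open>S\<close>. Its linear part drops out because the weighted mean of \<open>Z - W\<close> is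
    0.\<close>
  have "exp W * p = avg (cube I) (\<lambda>b. exp W * (S b * (1 - W) + S b * Z b))"
    unfolding avg_cmult avg_add avg_cmult_right SZ p(1)[symmetric] by (simp add: algebra_simps)
  also have "\<dots> \<le> avg (cube I) (\<lambda>b. exp (Z b))"
  proof (rule avg_mono)
    fix b assume b: "b \<in> cube I"
    have "exp W * (1 + (Z b - W)) \<le> exp W * exp (Z b - W)"
      by (intro mult_left_mono exp_ge_add_one_self) auto
    also have "\<dots> = exp (Z b)" by (simp add: exp_diff)
    finally have le: "exp W * (1 + (Z b - W)) \<le> exp (Z b)" .
    have "S b * (exp W * (1 + (Z b - W))) \<le> S b * exp (Z b)"
      using S[OF b] le by (intro mult_left_mono) auto
    also have "\<dots> \<le> 1 * exp (Z b)" using S[OF b] by (intro mult_right_mono) auto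
    finally show "exp W * (S b * (1 - W) + S b * Z b) \<le> exp (Z b)" by (simp add: algebra_simps)
  qed
  also have "\<dots> = (\<Prod>i\<in>I. cosh (v i))"
  proof -
    have "(\<Sum>b\<in>cube I. exp (Z b)) = (\<Sum>b\<in>cube I. \<Prod>i\<in>I. exp (v i * bit_sign (b i)))"
      by (simp add: Z_def exp_sum[OF I])
    also have "\<dots> = (\<Prod>i\<in>I. \<Sum>c\<in>{0, 1}. exp (v i * bit_sign c))"
      using I by (subst prod_sum_PiE) auto
    also have "\<dots> = (\<Prod>i\<in>I. 2 * cosh (v i))"
      by (intro prod.cong refl) (simp add: cosh_def)
    also have "\<dots> = 2 ^ card I * (\<Prod>i\<in>I. cosh (v i))" by (simp add: prod.distrib)
    finally show ?thesis unfolding avg_def card_cube[OF I] by simp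
  qed
  also have "\<dots> \<le> (\<Prod>i\<in>I. exp ((v i)\<^sup>2 / 2))"
    by (intro prod_mono) (auto intro: cosh_le_exp_half_square)
  also have "\<dots> = exp (W / 2)" by (simp add: W_def exp_sum[OF I, symmetric] sum_divide_distrib)
  finally have "exp (W / 2) * (exp (W / 2) * p) \<le> exp (W / 2) * 1"
    by (simp add: exp_add[symmetric] mult.assoc[symmetric])
  then have "exp (W / 2) * p \<le> 1" by (rule mult_left_le_imp_le) simp
  then have "ln (exp (W / 2) * p) \<le> ln 1" using p(2) by (subst ln_le_cancel_iff) auto
  then have "W \<le> 2 * (- ln p)" using p(2) by (simp add: ln_mult)
  then have "p\<^sup>2 * W \<le> p\<^sup>2 * (2 * (- ln p))" by (intro mult_left_mono) auto
  moreover have "(\<Sum>i\<in>I. (g i)\<^sup>2) = p\<^sup>2 * W"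
    using p(2) by (simp add: W_def v_def power_divide sum_divide_distrib[symmetric])
  ultimately show ?thesis
    unfolding g_def[symmetric] by (simp only: mult.left_commute mult.assoc)
qed

section \<open>Rectangle partitions along the path\<close>

text \<open>\<open>(sqrt a + sqrt b)\<^sup>2\<close> is at least \<open>a + b\<close>, and its
  product with the left side is \<open>(b - a)\<^sup>2\<close>. For \<open>a + b = 0\<close> both
  sides are 0, the right one by the convention for division by zero.\<close>

lemma sqrt_diff_square_le:
  assumes "a \<ge> 0" "b \<ge> 0"
  shows "(sqrt a - sqrt b)\<^sup>2 \<le> (b - a)\<^sup>2 / (a + b)"
proof (cases "a + b = 0")
  case True
  then show ?thesis using assms by (simp add: add_nonneg_eq_0_iff)
next
  case False
  then have pos: "a + b > 0" using assms by simp
  have "(sqrt a - sqrt b)\<^sup>2 * (a + b) \<le> (sqrt a - sqrt b)\<^sup>2 * (sqrt a + sqrt b)\<^sup>2"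
    using assms by (intro mult_left_mono) (auto simp: power2_sum)
  also have "\<dots> = ((sqrt a)\<^sup>2 - (sqrt b)\<^sup>2)\<^sup>2"
    by (simp add: power_mult_distrib[symmetric] square_diff_square_factored power2_eq_square algebra_simps)
  also have "\<dots> = (b - a)\<^sup>2" using assms by (simp add: power2_commute)
  finally show ?thesis using pos by (simp add: pos_le_divide_eq)
qed

text \<open>Entropy is largest for the uniform distribution: apply \<open>ln x \<le> x - 1\<close>
  to \<open>x = 1 / (P w * card W)\<close>.\<close>

lemma sum_neg_mult_ln_le_ln_card:
  assumes fin: "finite W" and P: "\<And>w. w \<in> W \<Longrightarrow> 0 \<le> P w" "sum P W = 1"
  shows "(\<Sum>w\<in>W. P w * (- ln (P w))) \<le> ln (real (card W))"
proof -
  have "W \<noteq> {}" using P(2) by auto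
  then have N: "real (card W) > 0" using fin by (simp add: card_gt_0_iff)
  have "P w * (- ln (P w)) - P w * ln (real (card W)) \<le> 1 / real (card W) - P w" if "w \<in> W" for w
  proof (cases "P w = 0")
    case False
    then have pos: "P w > 0" using P(1)[OF that] by simp
    have "ln (1 / (P w * real (card W))) \<le> 1 / (P w * real (card W)) - 1"
      using pos N by (intro ln_le_minus_one) simp
    moreover have "ln (1 / (P w * real (card W))) = - ln (P w) - ln (real (card W))"
      using pos N by (simp add: ln_div ln_mult)
    ultimately have "P w * (- ln (P w) - ln (real (card W))) \<le> P w * (1 / (P w * real (card W)) - 1)"
      using pos by (intro mult_left_mono) auto
    also have "\<dots> = 1 / real (card W) - P w" using pos by (simp add: right_diff_distrib)
    finally show ?thesis by (simp add: right_diff_distrib)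
  qed simp
  then have "(\<Sum>w\<in>W. P w * (- ln (P w)) - P w * ln (real (card W))) \<le> (\<Sum>w\<in>W. 1 / real (card W) - P w)"
    by (rule sum_mono)
  also have "\<dots> = 0" using N P(2) by (simp add: sum_subtractf)
  finally show ?thesis
    by (simp add: sum_subtractf sum_distrib_right[symmetric] P(2))
qed

lemma avg_01: "avg {0, 1 :: nat} F = (F 0 + F 1) / 2"
  by (simp add: avg_def)

lemma avg_cube_resample:
  assumes "finite I" "i \<in> I"
  shows "avg (cube I) F = avg {0, 1} (\<lambda>v. avg (cube I) (\<lambda>b. F (b(i := v))))"
  unfolding avg_swap[of "{0, 1}"] by (rule avg_PiE_resample[OF assms]) auto

text \<open>The pairs \<open>(s div 2, (s + 1) div 2)\<close> run through \<open>(0,0), (0,1), (1,1), (1,2), \<dots>\<close>.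
  The background input has in each cell \<open>i\<close> one of the two ends of the edge \<open>d i\<close> of this path;
  given \<open>d\<close>, the inputs of the two players are independent.\<close>

definition alice_cells :: "('i \<Rightarrow> nat) \<Rightarrow> ('i \<Rightarrow> nat) \<Rightarrow> 'i \<Rightarrow> nat" where
  "alice_cells d b = (\<lambda>i. (d i + b i) div 2)"

definition bob_cells :: "('i \<Rightarrow> nat) \<Rightarrow> ('i \<Rightarrow> nat) \<Rightarrow> 'i \<Rightarrow> nat" where
  "bob_cells d b = (\<lambda>i. (d i + b i + 1) div 2)"

lemma alice_cells_upd: "alice_cells d (b(i := v)) = (alice_cells d b)(i := (d i + v) div 2)"
  and bob_cells_upd: "bob_cells d (b(i := v)) = (bob_cells d b)(i := (d i + v + 1) div 2)"
  and alice_cells_edge_upd: "(alice_cells (d(i := e)) b)(i := a) = (alice_cells d b)(i := a)"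
  and bob_cells_edge_upd: "(bob_cells (d(i := e)) b)(i := a) = (bob_cells d b)(i := a)"
  by (auto simp: alice_cells_def bob_cells_def fun_eq_iff)

text \<open>On an even edge only Bob's entry depends on his bit, on an odd edge only Alice's depends
  on hers. So the independent bits of the players in cell \<open>i\<close> can be replaced by one
  common bit \<open>v\<close>, and the pair in that cell is always an end of the edge
  \<open>d i\<close>.\<close>

lemma avg_background:
  assumes I: "finite I" "i \<in> I"
  shows "avg (cube I) (\<lambda>b. avg (cube I) (\<lambda>b'. F (alice_cells d b) (bob_cells d b'))) =
    avg {0, 1} (\<lambda>v. avg (cube I) (\<lambda>b. avg (cube I) (\<lambda>b'.
      F ((alice_cells d b)(i := (d i + v) div 2)) ((bob_cells d b')(i := (d i + v + 1) div 2)))))"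
proof (cases "even (d i)")
  case True
  have x: "(alice_cells d b)(i := (d i + v) div 2) = alice_cells d b" if "b \<in> cube I" "v \<in> {0, 1}" for b v
    using True that I(2) by (auto simp: alice_cells_def fun_eq_iff PiE_iff elim!: evenE)
  have "avg (cube I) (\<lambda>b. avg (cube I) (\<lambda>b'. F (alice_cells d b) (bob_cells d b'))) =
    avg (cube I) (\<lambda>b. avg {0, 1} (\<lambda>v. avg (cube I) (\<lambda>b'. F (alice_cells d b) ((bob_cells d b')(i := (d i + v + 1) div 2)))))"
    unfolding bob_cells_upd[symmetric] by (intro avg_cong avg_cube_resample[OF I])
  also have "\<dots> = avg (cube I) (\<lambda>b. avg {0, 1} (\<lambda>v. avg (cube I) (\<lambda>b'.
      F ((alice_cells d b)(i := (d i + v) div 2)) ((bob_cells d b')(i := (d i + v + 1) div 2)))))"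
    using x by (intro avg_cong) simp
  finally show ?thesis unfolding avg_swap[of "cube I" "{0, 1}"] .
next
  case False
  have y: "(bob_cells d b)(i := (d i + v + 1) div 2) = bob_cells d b" if "b \<in> cube I" "v \<in> {0, 1}" for b v
    using False that I(2) by (auto simp: bob_cells_def fun_eq_iff PiE_iff elim!: oddE)
  have "avg (cube I) (\<lambda>b. avg (cube I) (\<lambda>b'. F (alice_cells d b) (bob_cells d b'))) =
    avg {0, 1} (\<lambda>v. avg (cube I) (\<lambda>b. avg (cube I) (\<lambda>b'. F ((alice_cells d b)(i := (d i + v) div 2)) (bob_cells d b'))))"
    unfolding alice_cells_upd[symmetric] by (rule avg_cube_resample[OF I])
  also have "\<dots> = avg {0, 1} (\<lambda>v. avg (cube I) (\<lambda>b. avg (cube I) (\<lambda>b'.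
      F ((alice_cells d b)(i := (d i + v) div 2)) ((bob_cells d b')(i := (d i + v + 1) div 2)))))"
    using y by (intro avg_cong) simp
  finally show ?thesis .
qed

section \<open>Leaf distributions and their Hellinger distances\<close>

text \<open>In the application \<open>S w\<close> and \<open>T w\<close> are the indicators of
  Alice's and Bob's sides of the rectangle of leaf \<open>w\<close>. Values in the unit interval are
  what the level-one inequality asks for.\<close>

locale rectangle_partition =
  fixes I :: "'i set" and W :: "'w set" and S T :: "'w \<Rightarrow> ('i \<Rightarrow> nat) \<Rightarrow> real"
  assumes finite_I: "finite I" and finite_W: "finite W"
    and S: "\<And>w x. 0 \<le> S w x" "\<And>w x. S w x \<le> 1"
    and T: "\<And>w y. 0 \<le> T w y" "\<And>w y. T w y \<le> 1"
    and partition: "\<And>x y. (\<Sum>w\<in>W. S w x * T w y) = 1"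
begin

text \<open>Given \<open>d\<close>, the inputs are independent, so
  \<open>\<alpha> d i a w * \<beta> d i c w\<close> is the probability of reaching leaf
  \<open>w\<close> when cell \<open>i\<close> is set to \<open>(a, c)\<close>. That pair need not
  lie on the path.\<close>

definition \<alpha> :: "('i \<Rightarrow> nat) \<Rightarrow> 'i \<Rightarrow> nat \<Rightarrow> 'w \<Rightarrow> real" where
  "\<alpha> d i a w = avg (cube I) (\<lambda>b. S w ((alice_cells d b)(i := a)))"

definition \<beta> :: "('i \<Rightarrow> nat) \<Rightarrow> 'i \<Rightarrow> nat \<Rightarrow> 'w \<Rightarrow> real" where
  "\<beta> d i c w = avg (cube I) (\<lambda>b. T w ((bob_cells d b)(i := c)))"

text \<open>Twice the squared Hellinger distance between the leaf distributions for
  \<open>(a, c)\<close> and \<open>(a', c')\<close> in cell \<open>i\<close>.\<close>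

definition hellinger :: "('i \<Rightarrow> nat) \<Rightarrow> 'i \<Rightarrow> nat \<Rightarrow> nat \<Rightarrow> nat \<Rightarrow> nat \<Rightarrow> real" where
  "hellinger d i a c a' c' =
     (\<Sum>w\<in>W. (sqrt (\<alpha> d i a w * \<beta> d i c w) - sqrt (\<alpha> d i a' w * \<beta> d i c' w))\<^sup>2)"

definition edge :: "('i \<Rightarrow> nat) \<Rightarrow> 'i \<Rightarrow> nat \<Rightarrow> real" where
  "edge d i e = hellinger d i (e div 2) ((e + 1) div 2) ((e + 1) div 2) ((e + 2) div 2)"

lemma \<alpha>_nonneg: "0 \<le> \<alpha> d i a w" and \<beta>_nonneg: "0 \<le> \<beta> d i c w"
  by (simp_all add: \<alpha>_def \<beta>_def avg_nonneg S T)

lemma hellinger_nonneg: "0 \<le> hellinger d i a c a' c'"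
  by (simp add: hellinger_def sum_nonneg)

lemma edge_nonneg: "0 \<le> edge d i e"
  by (simp add: edge_def hellinger_nonneg)

lemma avg_cube_const: "avg (cube I) (\<lambda>b. c) = c"
  by (rule avg_const[OF finite_cube[OF finite_I] cube_nonempty])

lemma sum_\<alpha>_\<beta>: "(\<Sum>w\<in>W. \<alpha> d i a w * \<beta> d i c w) = 1"
  unfolding \<alpha>_def \<beta>_def avg_mult_avg avg_sum[symmetric] partition avg_cube_const by (rule refl)

lemma \<alpha>_upd: "\<alpha> (d(i := e)) i = \<alpha> d i" and \<beta>_upd: "\<beta> (d(i := e)) i = \<beta> d i"
  by (simp_all add: \<alpha>_def \<beta>_def fun_eq_iff alice_cells_edge_upd bob_cells_edge_upd)

lemma edge_upd: "edge (d(i := e)) i = edge d i"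
  by (simp add: edge_def hellinger_def fun_eq_iff \<alpha>_upd \<beta>_upd)

text \<open>The square roots of the leaf probabilities telescope along the path; Cauchy-Schwarz
  turns \<open>n\<close> steps into a factor \<open>n\<close>.\<close>

lemma hellinger_path_le: "hellinger d i (s div 2) ((s + 1) div 2) ((s + n) div 2) ((s + n + 1) div 2)
    \<le> real n * (\<Sum>j<n. edge d i (s + j))"
proof -
  define U where "U w t = sqrt (\<alpha> d i (t div 2) w * \<beta> d i ((t + 1) div 2) w)" for w t
  have "(U w s - U w (s + n))\<^sup>2 \<le> real n * (\<Sum>j<n. (U w (s + j) - U w (s + j + 1))\<^sup>2)" for w
  proof -
    have "U w s - U w (s + n) = (\<Sum>j<n. U w (s + j) - U w (s + j + 1))"
      using sum_lessThan_telescope'[of "\<lambda>j. U w (s + j)" n] by simp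
    then show ?thesis
      using sum_squared_le_sum_of_squares[of "\<lambda>j. U w (s + j) - U w (s + j + 1)" "{..<n}"]
      by (simp add: mult.commute)
  qed
  then have "(\<Sum>w\<in>W. (U w s - U w (s + n))\<^sup>2)
      \<le> (\<Sum>w\<in>W. real n * (\<Sum>j<n. (U w (s + j) - U w (s + j + 1))\<^sup>2))"
    by (rule sum_mono)
  also have "\<dots> = real n * (\<Sum>j<n. \<Sum>w\<in>W. (U w (s + j) - U w (s + j + 1))\<^sup>2)"
    unfolding sum_distrib_left[symmetric] by (subst sum.swap) (rule refl)
  finally show ?thesis by (simp add: hellinger_def edge_def U_def)
qed

text \<open>The diagonal of a 2 by 2 grid of inputs controls its sides, a form of the cut-and-paste
  property. All four products of \<open>\<alpha>\<close> and \<open>\<beta>\<close> sum to 1 over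
  the leaves, so their alternating sum can be added for free; termwise the claim becomes
  \<open>0 \<le> 2 * (r * s) * (p - q)\<^sup>2\<close>.\<close>

lemma hellinger_pythagoras:
  "hellinger d i a c a c' + hellinger d i a' c a' c' \<le> 2 * hellinger d i a c a' c'" (is ?Y)
  "hellinger d i a c a' c + hellinger d i a c' a' c' \<le> 2 * hellinger d i a c a' c'" (is ?X)
proof -
  let ?a = "\<lambda>w. sqrt (\<alpha> d i a w)" and ?a' = "\<lambda>w. sqrt (\<alpha> d i a' w)"
  let ?b = "\<lambda>w. sqrt (\<beta> d i c w)" and ?b' = "\<lambda>w. sqrt (\<beta> d i c' w)"
  let ?R = "\<lambda>w. 2 * (?a w * ?b w - ?a' w * ?b' w)\<^sup>2 + (\<alpha> d i a w * \<beta> d i c' w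
      + \<alpha> d i a' w * \<beta> d i c w - \<alpha> d i a w * \<beta> d i c w - \<alpha> d i a' w * \<beta> d i c' w)"
  have R: "(\<Sum>w\<in>W. ?R w) = 2 * hellinger d i a c a' c'"
    by (simp add: sum.distrib sum_subtractf sum_\<alpha>_\<beta> hellinger_def real_sqrt_mult sum_distrib_left)
  have num: "(p * r - p * s)\<^sup>2 + (q * r - q * s)\<^sup>2 \<le> 2 * (p * r - q * s)\<^sup>2
      + (p\<^sup>2 * s\<^sup>2 + q\<^sup>2 * r\<^sup>2 - p\<^sup>2 * r\<^sup>2 - q\<^sup>2 * s\<^sup>2)" if "r \<ge> 0" "s \<ge> 0" for p q r s :: real
  proof -
    have "0 \<le> 2 * (r * s) * (p - q)\<^sup>2" using that by simp
    then show ?thesis by (simp add: power2_eq_square algebra_simps)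
  qed
  have "hellinger d i a c a c' + hellinger d i a' c a' c'
      = (\<Sum>w\<in>W. (?a w * ?b w - ?a w * ?b' w)\<^sup>2 + (?a' w * ?b w - ?a' w * ?b' w)\<^sup>2)"
    by (simp add: hellinger_def real_sqrt_mult sum.distrib)
  also have "\<dots> \<le> (\<Sum>w\<in>W. ?R w)"
  proof (rule sum_mono)
    fix w
    show "(?a w * ?b w - ?a w * ?b' w)\<^sup>2 + (?a' w * ?b w - ?a' w * ?b' w)\<^sup>2 \<le> ?R w"
      using num[of "?b w" "?b' w" "?a w" "?a' w"] by (simp add: \<alpha>_nonneg \<beta>_nonneg)
  qed
  finally show ?Y unfolding R .
  have "hellinger d i a c a' c + hellinger d i a c' a' c'
      = (\<Sum>w\<in>W. (?a w * ?b w - ?a' w * ?b w)\<^sup>2 + (?a w * ?b' w - ?a' w * ?b' w)\<^sup>2)"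
    by (simp add: hellinger_def real_sqrt_mult sum.distrib)
  also have "\<dots> \<le> (\<Sum>w\<in>W. ?R w)"
  proof (rule sum_mono)
    fix w
    show "(?a w * ?b w - ?a' w * ?b w)\<^sup>2 + (?a w * ?b' w - ?a' w * ?b' w)\<^sup>2 \<le> ?R w"
      using num[of "?a w" "?a' w" "?b w" "?b' w"] by (simp add: \<alpha>_nonneg \<beta>_nonneg mult.commute)
  qed
  finally show ?X unfolding R .
qed

end

text \<open>The difference is at most the absolute distance of the leaf distributions, which the
  Hellinger distance controls. Young's inequality with a free \<open>l\<close> takes the place of
  Cauchy-Schwarz: the bound is then linear in the squared distance and can be averaged over edges
  and cells.\<close>

lemma sum_diff_le_hellinger:
  fixes a b b' \<gamma> :: "'w \<Rightarrow> real"
  assumes fin: "finite W" and W': "W' \<subseteq> W" and \<gamma>: "\<And>w. 0 \<le> \<gamma> w" "\<And>w. \<gamma> w \<le> a w"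
    and nonneg: "\<And>w. 0 \<le> a w" "\<And>w. 0 \<le> b w" "\<And>w. 0 \<le> b' w"
    and sums: "(\<Sum>w\<in>W. a w * b w) = 1" "(\<Sum>w\<in>W. a w * b' w) = 1" and l: "l > 0"
  shows "(\<Sum>w\<in>W'. \<gamma> w * b' w) \<le> (\<Sum>w\<in>W'. \<gamma> w * b w) + 2 * l
    + (\<Sum>w\<in>W. (sqrt (a w * b w) - sqrt (a w * b' w))\<^sup>2) / (2 * l)"
proof -
  have "(\<Sum>w\<in>W'. \<gamma> w * b' w) - (\<Sum>w\<in>W'. \<gamma> w * b w) = (\<Sum>w\<in>W'. \<gamma> w * (b' w - b w))"
    by (simp add: sum_subtractf right_diff_distrib)
  also have "\<dots> \<le> (\<Sum>w\<in>W'. a w * \<bar>b' w - b w\<bar>)"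
  proof (rule sum_mono)
    fix w
    have "\<gamma> w * (b' w - b w) \<le> \<gamma> w * \<bar>b' w - b w\<bar>" using \<gamma> by (intro mult_left_mono) auto
    also have "\<dots> \<le> a w * \<bar>b' w - b w\<bar>" using \<gamma> by (intro mult_right_mono) auto
    finally show "\<gamma> w * (b' w - b w) \<le> a w * \<bar>b' w - b w\<bar>" .
  qed
  also have "\<dots> \<le> (\<Sum>w\<in>W. a w * \<bar>b' w - b w\<bar>)"
    using W' by (intro sum_mono2 fin) (auto simp: nonneg)
  also have "\<dots> \<le> (\<Sum>w\<in>W. l * (a w * b w + a w * b' w) + (sqrt (a w * b w) - sqrt (a w * b' w))\<^sup>2 / (2 * l))"
  proof (rule sum_mono)
    fix w
    define s where "s = sqrt (b w)"
    define s' where "s' = sqrt (b' w)"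
    have beq: "b w = s\<^sup>2" "b' w = s'\<^sup>2" and s: "s \<ge> 0" "s' \<ge> 0" by (simp_all add: s_def s'_def nonneg)
    have young: "x * y \<le> x\<^sup>2 / (2 * l) + l * y\<^sup>2 / 2" for x y :: real
    proof -
      have "0 \<le> (x - l * y)\<^sup>2 / (2 * l)" using l by simp
      also have "\<dots> = x\<^sup>2 / (2 * l) + l * y\<^sup>2 / 2 - x * y"
        using l by (simp add: power2_eq_square field_simps)
      finally show ?thesis by simp
    qed
    have "\<bar>b' w - b w\<bar> = \<bar>s - s'\<bar> * (s + s')"
      using s unfolding beq by (simp add: power2_eq_square square_diff_square_factored abs_mult abs_minus_commute mult.commute)
    also have "\<dots> \<le> \<bar>s - s'\<bar>\<^sup>2 / (2 * l) + l * (s + s')\<^sup>2 / 2" by (rule young)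
    also have "\<dots> \<le> (s - s')\<^sup>2 / (2 * l) + l * (s\<^sup>2 + s'\<^sup>2)"
    proof -
      have "(s + s')\<^sup>2 \<le> 2 * (s\<^sup>2 + s'\<^sup>2)" using zero_le_power2[of "s - s'"] by (simp add: power2_eq_square algebra_simps)
      then have "l * (s + s')\<^sup>2 \<le> l * (2 * (s\<^sup>2 + s'\<^sup>2))" using l by (intro mult_left_mono) auto
      also have "\<dots> = 2 * (l * (s\<^sup>2 + s'\<^sup>2))" by (rule mult.left_commute)
      finally show ?thesis unfolding power2_abs by linarith
    qed
    finally have "a w * \<bar>b' w - b w\<bar> \<le> a w * ((s - s')\<^sup>2 / (2 * l) + l * (s\<^sup>2 + s'\<^sup>2))"
      by (intro mult_left_mono) (auto simp: nonneg)
    also have "\<dots> = l * (a w * b w + a w * b' w) + (sqrt (a w * b w) - sqrt (a w * b' w))\<^sup>2 / (2 * l)"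
      by (simp add: beq real_sqrt_mult s right_diff_distrib[symmetric] power_mult_distrib nonneg)
        (simp add: algebra_simps)
    finally show "a w * \<bar>b' w - b w\<bar> \<le> l * (a w * b w + a w * b' w) + (sqrt (a w * b w) - sqrt (a w * b' w))\<^sup>2 / (2 * l)" .
  qed
  also have "\<dots> = 2 * l + (\<Sum>w\<in>W. (sqrt (a w * b w) - sqrt (a w * b' w))\<^sup>2) / (2 * l)"
    by (simp add: sum.distrib sum_distrib_left[symmetric] sum_divide_distrib[symmetric] sums)
  finally show ?thesis by simp
qed

context rectangle_partition
begin

text \<open>At the two ends of edge \<open>d i\<close> the leaf probabilities differ in one player's
  factor only, by twice the correlation of that factor with the bit of cell \<open>i\<close>. The
  level-one inequality bounds the squares of these correlations leaf by leaf, and the sum over the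
  leaves is an entropy.\<close>

lemma sum_edge_le: "(\<Sum>i\<in>I. edge d i (d i)) \<le> 4 * ln (real (card W))"
proof -
  define p where "p w = avg (cube I) (\<lambda>b. S w (alice_cells d b))" for w
  define q where "q w = avg (cube I) (\<lambda>b. T w (bob_cells d b))" for w
  define g where "g w i = avg (cube I) (\<lambda>b. S w (alice_cells d b) * bit_sign (b i))" for w i
  define h where "h w i = avg (cube I) (\<lambda>b. T w (bob_cells d b) * bit_sign (b i))" for w i
  have p01: "0 \<le> p w" "0 \<le> q w" for w
    unfolding p_def q_def by (simp_all add: avg_nonneg S T)
  have pq: "(\<Sum>w\<in>W. p w * q w) = 1"
    unfolding p_def q_def avg_mult_avg avg_sum[symmetric] partition avg_cube_const by (rule refl)
  have level: "(\<Sum>i\<in>I. (g w i)\<^sup>2) \<le> 2 * (p w)\<^sup>2 * (- ln (p w))" if "p w > 0" for w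
    unfolding g_def by (rule level_one_inequality[OF finite_I _ p_def that]) (simp add: S)
  have level': "(\<Sum>i\<in>I. (h w i)\<^sup>2) \<le> 2 * (q w)\<^sup>2 * (- ln (q w))" if "q w > 0" for w
    unfolding h_def by (rule level_one_inequality[OF finite_I _ q_def that]) (simp add: T)
  define a0 where "a0 w i = \<alpha> d i (d i div 2) w" for w i
  define a1 where "a1 w i = \<alpha> d i ((d i + 1) div 2) w" for w i
  define b0 where "b0 w i = \<beta> d i ((d i + 1) div 2) w" for w i
  define b1 where "b1 w i = \<beta> d i ((d i + 2) div 2) w" for w i
  have nn: "0 \<le> a0 w i" "0 \<le> a1 w i" "0 \<le> b0 w i" "0 \<le> b1 w i" for w i
    by (simp_all add: a0_def a1_def b0_def b1_def \<alpha>_nonneg \<beta>_nonneg)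
  have p_eq: "p w = (a0 w i + a1 w i) / 2" and g_eq: "g w i = (a1 w i - a0 w i) / 2" if "i \<in> I" for w i
  proof -
    show "p w = (a0 w i + a1 w i) / 2"
      unfolding p_def a0_def a1_def \<alpha>_def
      by (subst avg_cube_resample[OF finite_I that]) (simp only: avg_01 alice_cells_upd add_0_right)
    have "g w i = avg {0, 1} (\<lambda>v. avg (cube I) (\<lambda>b. bit_sign v * S w ((alice_cells d b)(i := (d i + v) div 2))))"
      unfolding g_def by (subst avg_cube_resample[OF finite_I that]) (simp only: alice_cells_upd fun_upd_same mult.commute)
    also have "\<dots> = (a1 w i - a0 w i) / 2"
      unfolding avg_cmult avg_01 a0_def a1_def \<alpha>_def by simp
    finally show "g w i = (a1 w i - a0 w i) / 2" .
  qed
  have q_eq: "q w = (b0 w i + b1 w i) / 2" and h_eq: "h w i = (b1 w i - b0 w i) / 2" if "i \<in> I" for w i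
  proof -
    have two: "d i + 1 + 1 = d i + 2" by simp
    show "q w = (b0 w i + b1 w i) / 2"
      unfolding q_def b0_def b1_def \<beta>_def
      by (subst avg_cube_resample[OF finite_I that]) (simp only: avg_01 bob_cells_upd add_0_right two)
    have "h w i = avg {0, 1} (\<lambda>v. avg (cube I) (\<lambda>b. bit_sign v * T w ((bob_cells d b)(i := (d i + v + 1) div 2))))"
      unfolding h_def by (subst avg_cube_resample[OF finite_I that]) (simp only: bob_cells_upd fun_upd_same mult.commute)
    also have "\<dots> = (b1 w i - b0 w i) / 2"
      unfolding avg_cmult avg_01 b0_def b1_def \<beta>_def by simp
    finally show "h w i = (b1 w i - b0 w i) / 2" .
  qed
  have quarter: "2 * r * ((x / 2)\<^sup>2 / (y / 2)) = r * (x\<^sup>2 / y)" for r x y :: real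
    by (cases "y = 0") (simp_all add: field_simps power2_eq_square)
  have term_le: "(sqrt (a0 w i * b0 w i) - sqrt (a1 w i * b1 w i))\<^sup>2
      \<le> 2 * p w * ((h w i)\<^sup>2 / q w) + 2 * q w * ((g w i)\<^sup>2 / p w)" if i: "i \<in> I" for w i
  proof (cases "even (d i)")
    case True
    then have eq: "a1 w i = a0 w i" by (auto simp: a0_def a1_def elim!: evenE)
    then have pa: "p w = a0 w i" by (simp add: p_eq[OF i])
    have "(sqrt (a0 w i * b0 w i) - sqrt (a1 w i * b1 w i))\<^sup>2 = a0 w i * (sqrt (b0 w i) - sqrt (b1 w i))\<^sup>2"
      using nn by (simp add: eq real_sqrt_mult right_diff_distrib[symmetric] power_mult_distrib)
    also have "\<dots> \<le> a0 w i * ((b1 w i - b0 w i)\<^sup>2 / (b0 w i + b1 w i))"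
      using nn by (intro mult_left_mono sqrt_diff_square_le) auto
    also have "\<dots> = 2 * p w * ((h w i)\<^sup>2 / q w)"
      unfolding pa h_eq[OF i] q_eq[OF i] quarter ..
    also have "\<dots> \<le> 2 * p w * ((h w i)\<^sup>2 / q w) + 2 * q w * ((g w i)\<^sup>2 / p w)"
      using p01 by simp
    finally show ?thesis .
  next
    case False
    then have eq: "b1 w i = b0 w i" by (auto simp: b0_def b1_def elim!: oddE)
    then have qb: "q w = b0 w i" by (simp add: q_eq[OF i])
    have "(sqrt (a0 w i * b0 w i) - sqrt (a1 w i * b1 w i))\<^sup>2 = b0 w i * (sqrt (a0 w i) - sqrt (a1 w i))\<^sup>2"
      using nn by (simp add: eq real_sqrt_mult left_diff_distrib[symmetric] power_mult_distrib)
    also have "\<dots> \<le> b0 w i * ((a1 w i - a0 w i)\<^sup>2 / (a0 w i + a1 w i))"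
      using nn by (intro mult_left_mono sqrt_diff_square_le) auto
    also have "\<dots> = 2 * q w * ((g w i)\<^sup>2 / p w)"
      unfolding qb g_eq[OF i] p_eq[OF i] quarter ..
    also have "\<dots> \<le> 2 * p w * ((h w i)\<^sup>2 / q w) + 2 * q w * ((g w i)\<^sup>2 / p w)"
      using p01 by simp
    finally show ?thesis .
  qed
  \<comment> \<open>Applied with Bob's factor as \<open>s\<close> and Alice's as \<open>r\<close>,
    and conversely. For \<open>s = 0\<close> the quotient is 0.\<close>
  have half: "2 * r * ((\<Sum>i\<in>I. (f i)\<^sup>2) / s) \<le> 4 * (r * s) * (- ln s)"
    if "0 \<le> r" "0 \<le> s" "s > 0 \<Longrightarrow> (\<Sum>i\<in>I. (f i)\<^sup>2) \<le> 2 * s\<^sup>2 * (- ln s)" for r s and f :: "'i \<Rightarrow> real"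
  proof (cases "s = 0")
    case False
    then have "s > 0" using that by simp
    then have "(\<Sum>i\<in>I. (f i)\<^sup>2) / s \<le> (2 * s\<^sup>2 * (- ln s)) / s"
      using that(3) by (intro divide_right_mono) auto
    also have "\<dots> = 2 * s * (- ln s)" using \<open>s > 0\<close> by (simp add: power2_eq_square)
    finally have "2 * r * ((\<Sum>i\<in>I. (f i)\<^sup>2) / s) \<le> 2 * r * (2 * s * (- ln s))"
      using that(1) by (intro mult_left_mono) auto
    then show ?thesis by (simp add: algebra_simps)
  qed simp
  have "(\<Sum>i\<in>I. edge d i (d i)) = (\<Sum>w\<in>W. \<Sum>i\<in>I. (sqrt (a0 w i * b0 w i) - sqrt (a1 w i * b1 w i))\<^sup>2)"
    unfolding edge_def hellinger_def a0_def a1_def b0_def b1_def by (subst sum.swap) (rule refl)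
  also have "\<dots> \<le> (\<Sum>w\<in>W. 4 * (p w * q w * (- ln (p w * q w))))"
  proof (rule sum_mono)
    fix w
    have "(\<Sum>i\<in>I. (sqrt (a0 w i * b0 w i) - sqrt (a1 w i * b1 w i))\<^sup>2)
        \<le> (\<Sum>i\<in>I. 2 * p w * ((h w i)\<^sup>2 / q w) + 2 * q w * ((g w i)\<^sup>2 / p w))"
      by (intro sum_mono term_le)
    also have "\<dots> = 2 * p w * ((\<Sum>i\<in>I. (h w i)\<^sup>2) / q w) + 2 * q w * ((\<Sum>i\<in>I. (g w i)\<^sup>2) / p w)"
      by (simp add: sum.distrib sum_distrib_left sum_divide_distrib)
    also have "\<dots> \<le> 4 * (p w * q w) * (- ln (q w)) + 4 * (q w * p w) * (- ln (p w))"
      by (intro add_mono half p01 level level')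
    also have "\<dots> = 4 * (p w * q w * (- ln (p w * q w)))"
      using p01[of w] by (cases "p w = 0 \<or> q w = 0") (auto simp: ln_mult algebra_simps)
    finally show "(\<Sum>i\<in>I. (sqrt (a0 w i * b0 w i) - sqrt (a1 w i * b1 w i))\<^sup>2)
        \<le> 4 * (p w * q w * (- ln (p w * q w)))" .
  qed
  also have "\<dots> \<le> 4 * ln (real (card W))"
    unfolding sum_distrib_left[symmetric]
    by (intro mult_left_mono sum_neg_mult_ln_le_ln_card[OF finite_W _ pq]) (simp_all add: p01)
  finally show ?thesis .
qed

end

lemma sum_shift_le:
  fixes f :: "nat \<Rightarrow> real"
  assumes "\<And>e. 0 \<le> f e" "m + n \<le> N"
  shows "(\<Sum>e<m. f (e + n)) \<le> (\<Sum>e<N. f e)"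
proof -
  have "(\<Sum>e<m. f (e + n)) = (\<Sum>e\<in>(\<lambda>e. e + n) ` {..<m}. f e)" by (subst sum.reindex) auto
  also have "\<dots> \<le> (\<Sum>e<N. f e)" using assms by (intro sum_mono2) auto
  finally show ?thesis .
qed

section \<open>The answer of the protocol\<close>

text \<open>\<open>WA\<close> and \<open>WB\<close> are the leaves at which Alice, respectively Bob,
  announces the output, which may depend on that player's input. \<open>cA\<close> and
  \<open>cB\<close> are the columns read off from it; in the application \<open>colour\<close> is
  the column of a cell.\<close>

locale labelled_partition = rectangle_partition I W S T
  for I :: "'i set" and W :: "'w set" and S T :: "'w \<Rightarrow> ('i \<Rightarrow> nat) \<Rightarrow> real" +
  fixes WA WB :: "'w set" and cA cB :: "'w \<Rightarrow> ('i \<Rightarrow> nat) \<Rightarrow> 'c" and colour :: "'i \<Rightarrow> 'c"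
  assumes WA_WB: "W = WA \<union> WB" "WA \<inter> WB = {}"
begin

text \<open>For 0-1 valued \<open>S\<close> and \<open>T\<close> this is the indicator that the
  answer on \<open>(x, y)\<close> is the colour of cell \<open>i\<close>: only the leaf that is
  reached contributes.\<close>

definition hit :: "'i \<Rightarrow> ('i \<Rightarrow> nat) \<Rightarrow> ('i \<Rightarrow> nat) \<Rightarrow> real" where
  "hit i x y = (\<Sum>w\<in>WA. S w x * T w y * of_bool (cA w x = colour i))
     + (\<Sum>w\<in>WB. S w x * T w y * of_bool (cB w y = colour i))"

definition hit_avg :: "('i \<Rightarrow> nat) \<Rightarrow> 'i \<Rightarrow> nat \<Rightarrow> nat \<Rightarrow> real" where
  "hit_avg d i a c = avg (cube I) (\<lambda>b. avg (cube I) (\<lambda>b'. hit i ((alice_cells d b)(i := a)) ((bob_cells d b')(i := c))))"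

text \<open>The part of \<open>\<alpha>\<close> in which Alice, announcing the output at
  \<open>w\<close>, names the colour of cell \<open>i\<close>; \<open>\<delta>\<close> is its
  counterpart for Bob.\<close>

definition \<gamma> :: "('i \<Rightarrow> nat) \<Rightarrow> 'i \<Rightarrow> nat \<Rightarrow> 'w \<Rightarrow> real" where
  "\<gamma> d i a w = avg (cube I) (\<lambda>b. S w ((alice_cells d b)(i := a)) * of_bool (cA w ((alice_cells d b)(i := a)) = colour i))"

definition \<delta> :: "('i \<Rightarrow> nat) \<Rightarrow> 'i \<Rightarrow> nat \<Rightarrow> 'w \<Rightarrow> real" where
  "\<delta> d i c w = avg (cube I) (\<lambda>b. T w ((bob_cells d b)(i := c)) * of_bool (cB w ((bob_cells d b)(i := c)) = colour i))"

definition hit_avg_A :: "('i \<Rightarrow> nat) \<Rightarrow> 'i \<Rightarrow> nat \<Rightarrow> nat \<Rightarrow> real" where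
  "hit_avg_A d i a c = (\<Sum>w\<in>WA. \<gamma> d i a w * \<beta> d i c w)"

definition hit_avg_B :: "('i \<Rightarrow> nat) \<Rightarrow> 'i \<Rightarrow> nat \<Rightarrow> nat \<Rightarrow> real" where
  "hit_avg_B d i a c = (\<Sum>w\<in>WB. \<delta> d i c w * \<alpha> d i a w)"

lemma finite_WA_WB: "finite WA" "finite WB" and sub: "WA \<subseteq> W" "WB \<subseteq> W"
  using finite_W WA_WB by auto

lemma \<gamma>_\<delta>: "0 \<le> \<gamma> d i a w" "\<gamma> d i a w \<le> \<alpha> d i a w" "0 \<le> \<delta> d i c w" "\<delta> d i c w \<le> \<beta> d i c w"
  unfolding \<gamma>_def \<delta>_def \<alpha>_def \<beta>_def by (auto intro!: avg_nonneg avg_mono simp: S T)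

lemma hit_avg_AB_nonneg: "0 \<le> hit_avg_A d i a c" "0 \<le> hit_avg_B d i a c"
  unfolding hit_avg_A_def hit_avg_B_def by (auto intro!: sum_nonneg mult_nonneg_nonneg simp: \<gamma>_\<delta> \<alpha>_nonneg \<beta>_nonneg)

lemma hit_avg_eq: "hit_avg d i a c = hit_avg_A d i a c + hit_avg_B d i a c"
proof -
  have "hit_avg_B d i a c = (\<Sum>w\<in>WB. \<alpha> d i a w * \<delta> d i c w)" by (simp add: hit_avg_B_def mult.commute)
  then show ?thesis
    unfolding hit_avg_A_def hit_avg_def hit_def \<gamma>_def \<delta>_def \<alpha>_def \<beta>_def avg_add avg_sum avg_mult_avg
    by (simp add: mult_ac)
qed

lemma hit_le: "hit i x y \<le> 1"
proof -
  have "hit i x y \<le> (\<Sum>w\<in>WA. S w x * T w y) + (\<Sum>w\<in>WB. S w x * T w y)"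
    unfolding hit_def by (intro add_mono sum_mono) (auto simp: S T)
  also have "\<dots> = (\<Sum>w\<in>W. S w x * T w y)"
    unfolding WA_WB(1) using finite_WA_WB WA_WB(2) by (simp add: sum.union_disjoint)
  finally show ?thesis by (simp add: partition)
qed

lemma hit_avg_le_1: "hit_avg d i a c \<le> 1"
  unfolding hit_avg_def by (intro avg_le_1 hit_le)

lemma hit_avg_upd: "hit_avg (d(i := e)) i = hit_avg d i"
  by (simp add: hit_avg_def fun_eq_iff alice_cells_edge_upd bob_cells_edge_upd)

text \<open>In the application \<open>(a, c)\<close> and \<open>(a', c')\<close> lie on the path and
  \<open>(a, c')\<close> does not. Where Alice answers, \<open>\<gamma>\<close> depends on
  \<open>a\<close> alone, so Bob's entry is changed from \<open>c'\<close> to \<open>c\<close>;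
  where Bob answers, Alice's is changed from \<open>a\<close> to \<open>a'\<close>.
  \<open>hellinger_pythagoras\<close> bounds both changes by the distance between the two pairs on
  the path.\<close>

lemma hit_avg_shift_le:
  assumes l: "l > 0"
  shows "hit_avg d i a c' \<le> hit_avg_A d i a c + hit_avg_B d i a' c' + 4 * l + 2 / l * hellinger d i a c a' c'"
proof -
  have A: "hit_avg_A d i a c' \<le> hit_avg_A d i a c + 2 * l + hellinger d i a c a c' / (2 * l)"
    unfolding hit_avg_A_def hellinger_def
    by (rule sum_diff_le_hellinger[OF finite_W sub(1)])
      (simp_all add: \<gamma>_\<delta> \<alpha>_nonneg \<beta>_nonneg sum_\<alpha>_\<beta> l)
  have "hit_avg_B d i a c' \<le> hit_avg_B d i a' c' + 2 * l
      + (\<Sum>w\<in>W. (sqrt (\<beta> d i c' w * \<alpha> d i a' w) - sqrt (\<beta> d i c' w * \<alpha> d i a w))\<^sup>2) / (2 * l)"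
    unfolding hit_avg_B_def
    by (rule sum_diff_le_hellinger[OF finite_W sub(2)])
      (simp_all add: \<gamma>_\<delta> \<alpha>_nonneg \<beta>_nonneg sum_\<alpha>_\<beta> l mult.commute[of "\<beta> _ _ _ _"])
  also have "(\<Sum>w\<in>W. (sqrt (\<beta> d i c' w * \<alpha> d i a' w) - sqrt (\<beta> d i c' w * \<alpha> d i a w))\<^sup>2) = hellinger d i a c' a' c'"
    unfolding hellinger_def by (subst power2_commute) (simp add: mult.commute)
  finally have B: "hit_avg_B d i a c' \<le> hit_avg_B d i a' c' + 2 * l + hellinger d i a c' a' c' / (2 * l)" .
  have "hellinger d i a c a c' / (2 * l) \<le> hellinger d i a c a' c' / l" "hellinger d i a c' a' c' / (2 * l) \<le> hellinger d i a c a' c' / l"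
    using hellinger_pythagoras(1)[of d i a c c' a'] hellinger_pythagoras(2)[of d i a c a' c'] hellinger_nonneg[of d i a' c a' c'] hellinger_nonneg[of d i a c a' c] l
    by (auto simp: field_simps)
  with A B show ?thesis unfolding hit_avg_eq by simp
qed

text \<open>Advancing by \<open>2 * B\<close> on the path adds \<open>B\<close> to both entries.
  Alice's hits at \<open>s\<close> and Bob's hits at \<open>s + 2 * B\<close>, summed over all
  positions, make up at most the unplanted hits. Each edge is crossed by at most
  \<open>2 * B\<close> walks of length \<open>2 * B\<close>, whence the square of \<open>B\<close>;
  the last \<open>2 * B\<close> positions are counted with 1.\<close>

lemma sum_hit_avg_shift_le:
  assumes l: "l > 0" and K: "2 * B \<le> K" and v: "v \<le> 1"
  shows "(\<Sum>e<K. hit_avg d i ((e + v) div 2) ((e + v + 1) div 2 + B))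
    \<le> (\<Sum>e<K. hit_avg d i ((e + v) div 2) ((e + v + 1) div 2)) + 4 * l * real K
      + 8 * (real B)\<^sup>2 / l * (\<Sum>e<K. edge d i e) + 2 * real B"
proof -
  define A where "A s = hit_avg_A d i (s div 2) ((s + 1) div 2)" for s
  define A' where "A' s = hit_avg_B d i (s div 2) ((s + 1) div 2)" for s
  \<comment> \<open>For \<open>e < L\<close>, \<open>v \<le> 1\<close> and \<open>j < 2 * B\<close>
    the edge \<open>e + v + j\<close> is still below \<open>K\<close>.\<close>
  define L where "L = K - 2 * B"
  let ?E = "\<Sum>e<K. edge d i e"
  have nn: "0 \<le> A s" "0 \<le> A' s" for s by (simp_all add: A_def A'_def hit_avg_AB_nonneg)
  have point: "hit_avg d i (s div 2) ((s + 1) div 2 + B)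
      \<le> A s + A' (s + 2 * B) + 4 * l + 4 * real B / l * (\<Sum>j<2 * B. edge d i (s + j))" for s
  proof -
    have div: "(s + 2 * B) div 2 = s div 2 + B" "(s + 2 * B + 1) div 2 = (s + 1) div 2 + B" by simp_all
    have "2 / l * hellinger d i (s div 2) ((s + 1) div 2) (s div 2 + B) ((s + 1) div 2 + B)
        \<le> 2 / l * (real (2 * B) * (\<Sum>j<2 * B. edge d i (s + j)))"
      using hellinger_path_le[of d i s "2 * B"] l unfolding div by (intro mult_left_mono) auto
    then show ?thesis
      using hit_avg_shift_le[OF l, of d i "s div 2" "(s + 1) div 2 + B" "(s + 1) div 2" "s div 2 + B"]
      unfolding A_def A'_def div by (simp add: algebra_simps)
  qed
  have "(\<Sum>e<K. hit_avg d i ((e + v) div 2) ((e + v + 1) div 2 + B))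
      = (\<Sum>e<L. hit_avg d i ((e + v) div 2) ((e + v + 1) div 2 + B))
      + (\<Sum>e\<in>{L..<K}. hit_avg d i ((e + v) div 2) ((e + v + 1) div 2 + B))"
    unfolding L_def by (simp add: atLeast0LessThan[symmetric] sum.atLeastLessThan_concat)
  also have "(\<Sum>e\<in>{L..<K}. hit_avg d i ((e + v) div 2) ((e + v + 1) div 2 + B)) \<le> (\<Sum>e\<in>{L..<K}. 1)"
    by (intro sum_mono hit_avg_le_1)
  also have "\<dots> = 2 * real B" using K by (simp add: L_def)
  also have "(\<Sum>e<L. hit_avg d i ((e + v) div 2) ((e + v + 1) div 2 + B))
      \<le> (\<Sum>e<L. A (e + v) + A' (e + v + 2 * B) + 4 * l + 4 * real B / l * (\<Sum>j<2 * B. edge d i (e + v + j)))"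
    by (intro sum_mono point)
  also have "\<dots> = (\<Sum>e<L. A (e + v)) + (\<Sum>e<L. A' (e + 2 * B + v)) + 4 * l * real L
      + 4 * real B / l * (\<Sum>j<2 * B. \<Sum>e<L. edge d i (e + (v + j)))"
    unfolding sum.distrib sum_distrib_left[symmetric] by (subst sum.swap) (simp add: add_ac)
  also have "\<dots> \<le> (\<Sum>e<K. A (e + v)) + (\<Sum>e<K. A' (e + v)) + 4 * l * real K
      + 4 * real B / l * (\<Sum>j<2 * B. ?E)"
  proof (intro add_mono mult_left_mono sum_mono)
    show "(\<Sum>e<L. A (e + v)) \<le> (\<Sum>e<K. A (e + v))" by (intro sum_mono2) (auto simp: nn L_def)
    show "(\<Sum>e<L. A' (e + 2 * B + v)) \<le> (\<Sum>e<K. A' (e + v))"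
      using K by (intro sum_shift_le[of "\<lambda>e. A' (e + v)"]) (auto simp: nn L_def)
    fix j assume "j \<in> {..<2 * B}"
    then show "(\<Sum>e<L. edge d i (e + (v + j))) \<le> ?E"
      using K v by (intro sum_shift_le edge_nonneg) (auto simp: L_def)
  qed (use l in \<open>auto simp: L_def\<close>)
  also have "(\<Sum>e<K. A (e + v)) + (\<Sum>e<K. A' (e + v)) = (\<Sum>e<K. hit_avg d i ((e + v) div 2) ((e + v + 1) div 2))"
    unfolding sum.distrib[symmetric] hit_avg_eq A_def A'_def by (rule refl)
  also have "4 * real B / l * (\<Sum>j<2 * B. ?E) = 8 * (real B)\<^sup>2 / l * ?E"
    by (simp add: power2_eq_square)
  finally show ?thesis by simp
qed

text \<open>On a fixed input the answer is one colour, chosen without regard to \<open>i\<close>,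
  and a single colour fits at most a fraction \<open>\<mu>\<close> of the cells.\<close>

lemma avg_hit_le:
  assumes m: "\<And>c. real (card {i \<in> I. colour i = c}) \<le> \<mu> * real (card I)" and I: "I \<noteq> {}"
  shows "avg I (\<lambda>i. hit i x y) \<le> \<mu>"
proof -
  have pos: "real (card I) > 0" using I finite_I by (simp add: card_gt_0_iff)
  have col: "avg I (\<lambda>i. of_bool (c = colour i)) \<le> \<mu>" for c
  proof -
    have "{i \<in> I. colour i = c} = I \<inter> {i. c = colour i}" by auto
    then have "(\<Sum>i\<in>I. of_bool (c = colour i)) = real (card {i \<in> I. colour i = c})"
      using finite_I by simp
    then show ?thesis using m[of c] pos by (simp add: avg_def divide_le_eq)
  qed
  have "avg I (\<lambda>i. hit i x y) = (\<Sum>w\<in>WA. S w x * T w y * avg I (\<lambda>i. of_bool (cA w x = colour i)))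
     + (\<Sum>w\<in>WB. S w x * T w y * avg I (\<lambda>i. of_bool (cB w y = colour i)))"
    unfolding hit_def avg_add avg_sum avg_cmult ..
  also have "\<dots> \<le> (\<Sum>w\<in>WA. S w x * T w y * \<mu>) + (\<Sum>w\<in>WB. S w x * T w y * \<mu>)"
    by (intro add_mono sum_mono mult_left_mono col) (auto simp: S T)
  also have "\<dots> = (\<Sum>w\<in>W. S w x * T w y) * \<mu>"
    unfolding WA_WB(1) sum_distrib_right using finite_WA_WB WA_WB(2) by (simp add: sum.union_disjoint)
  finally show ?thesis by (simp add: partition)
qed

text \<open>Once the entries of cell \<open>i\<close> are overwritten, nothing depends on
  \<open>d i\<close>, so this edge can be redrawn and the sum over the whole path used. Removing the
  shift leads back to the background input, which is independent of \<open>i\<close>; there the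
  answer is a guess.\<close>

lemma avg_planted_hit_le:
  assumes m: "\<And>c. real (card {i \<in> I. colour i = c}) \<le> \<mu> * real (card I)" and I: "I \<noteq> {}"
    and l: "l > 0" and K: "2 * B \<le> K" "K > 0"
  shows "avg (PiE I (\<lambda>_. {..<K})) (\<lambda>d. avg I (\<lambda>i. avg {0, 1} (\<lambda>v. hit_avg d i ((d i + v) div 2) ((d i + v + 1) div 2 + B))))
    \<le> \<mu> + 4 * l + 2 * real B / real K + 32 * (real B)\<^sup>2 * ln (real (card W)) / (l * real (card I))"
proof -
  let ?D = "PiE I (\<lambda>_. {..<K})" and ?m = "real (card I)"
  have pos: "?m > 0" using I finite_I by (simp add: card_gt_0_iff)
  have finD: "finite ?D" "?D \<noteq> {}" using finite_I K by (auto simp: finite_PiE PiE_eq_empty_iff)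
  have resample: "avg ?D (\<lambda>d. F d (d i)) = avg ?D (\<lambda>d. avg {..<K} (F d))"
    if "i \<in> I" "\<And>d e. F (d(i := e)) = F d" for i and F :: "_ \<Rightarrow> nat \<Rightarrow> real"
    by (subst avg_PiE_resample[OF finite_I that(1)]) (use K that(2) in auto)
  have one: "avg ?D (\<lambda>d. avg {0, 1} (\<lambda>v. hit_avg d i ((d i + v) div 2) ((d i + v + 1) div 2 + B)))
      \<le> avg ?D (\<lambda>d. avg (cube I) (\<lambda>b. avg (cube I) (\<lambda>b'. hit i (alice_cells d b) (bob_cells d b'))))
        + 4 * l + 2 * real B / real K + 8 * (real B)\<^sup>2 / l * avg ?D (\<lambda>d. edge d i (d i))" if i: "i \<in> I" for i
  proof -
    have "avg ?D (\<lambda>d. avg {0, 1} (\<lambda>v. hit_avg d i ((d i + v) div 2) ((d i + v + 1) div 2 + B)))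
        = avg ?D (\<lambda>d. avg {0, 1} (\<lambda>v. avg {..<K} (\<lambda>e. hit_avg d i ((e + v) div 2) ((e + v + 1) div 2 + B))))"
      unfolding avg_swap[of "{0, 1}"]
      by (rule resample[OF i, of "\<lambda>d e. avg {0, 1} (\<lambda>v. hit_avg d i ((e + v) div 2) ((e + v + 1) div 2 + B))"])
        (simp add: hit_avg_upd)
    also have "\<dots> \<le> avg ?D (\<lambda>d. avg {0, 1} (\<lambda>v. avg {..<K} (\<lambda>e. hit_avg d i ((e + v) div 2) ((e + v + 1) div 2))
        + 4 * l + 8 * (real B)\<^sup>2 / l * avg {..<K} (edge d i) + 2 * real B / real K))"
    proof (intro avg_mono)
      fix d :: "'i \<Rightarrow> nat" and v :: nat assume "v \<in> {0, 1}"
      then have "v \<le> 1" by auto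
      from divide_right_mono[OF sum_hit_avg_shift_le[OF l K(1) this, of d i], of "real K"]
      show "avg {..<K} (\<lambda>e. hit_avg d i ((e + v) div 2) ((e + v + 1) div 2 + B))
        \<le> avg {..<K} (\<lambda>e. hit_avg d i ((e + v) div 2) ((e + v + 1) div 2))
          + 4 * l + 8 * (real B)\<^sup>2 / l * avg {..<K} (edge d i) + 2 * real B / real K"
        using K(2) by (simp add: avg_def add_divide_distrib)
    qed
    also have "\<dots> = avg ?D (\<lambda>d. avg {..<K} (\<lambda>e. avg {0, 1} (\<lambda>v. hit_avg d i ((e + v) div 2) ((e + v + 1) div 2))))
        + 4 * l + 8 * (real B)\<^sup>2 / l * avg ?D (\<lambda>d. avg {..<K} (edge d i)) + 2 * real B / real K"
      unfolding avg_swap[of "{..<K}"] avg_add avg_cmult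
      using finD by (simp add: avg_const)
    also have "avg ?D (\<lambda>d. avg {..<K} (\<lambda>e. avg {0, 1} (\<lambda>v. hit_avg d i ((e + v) div 2) ((e + v + 1) div 2))))
        = avg ?D (\<lambda>d. avg {0, 1} (\<lambda>v. hit_avg d i ((d i + v) div 2) ((d i + v + 1) div 2)))"
      by (rule resample[OF i, of "\<lambda>d e. avg {0, 1} (\<lambda>v. hit_avg d i ((e + v) div 2) ((e + v + 1) div 2))", symmetric])
        (simp add: hit_avg_upd)
    \<comment> \<open>Without the shift, the two ends of the edge average to the background
      input.\<close>
    also have "\<dots> = avg ?D (\<lambda>d. avg (cube I) (\<lambda>b. avg (cube I) (\<lambda>b'. hit i (alice_cells d b) (bob_cells d b'))))"
      unfolding hit_avg_def by (subst avg_background[OF finite_I i]) (rule refl)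
    also have "avg ?D (\<lambda>d. avg {..<K} (edge d i)) = avg ?D (\<lambda>d. edge d i (d i))"
      by (rule resample[OF i, of "\<lambda>d. edge d i", symmetric]) (simp add: edge_upd)
    finally show ?thesis by simp
  qed
  have "avg ?D (\<lambda>d. avg I (\<lambda>i. avg {0, 1} (\<lambda>v. hit_avg d i ((d i + v) div 2) ((d i + v + 1) div 2 + B))))
    = avg I (\<lambda>i. avg ?D (\<lambda>d. avg {0, 1} (\<lambda>v. hit_avg d i ((d i + v) div 2) ((d i + v + 1) div 2 + B))))"
    by (rule avg_swap)
  also have "\<dots> \<le> avg I (\<lambda>i. avg ?D (\<lambda>d. avg (cube I) (\<lambda>b. avg (cube I) (\<lambda>b'. hit i (alice_cells d b) (bob_cells d b'))))
        + 4 * l + 2 * real B / real K + 8 * (real B)\<^sup>2 / l * avg ?D (\<lambda>d. edge d i (d i)))"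
    by (intro avg_mono one)
  also have "\<dots> = avg ?D (\<lambda>d. avg (cube I) (\<lambda>b. avg (cube I) (\<lambda>b'. avg I (\<lambda>i. hit i (alice_cells d b) (bob_cells d b')))))
        + 4 * l + 2 * real B / real K + 8 * (real B)\<^sup>2 / l * avg ?D (\<lambda>d. avg I (\<lambda>i. edge d i (d i)))"
    unfolding avg_swap[of "I"] avg_add avg_cmult avg_const[OF finite_I I] ..
  also have "\<dots> \<le> \<mu> + 4 * l + 2 * real B / real K + 8 * (real B)\<^sup>2 / l * (4 * ln (real (card W)) / ?m)"
  proof (intro add_mono mult_left_mono order_refl)
    have "avg ?D (\<lambda>d. avg (cube I) (\<lambda>b. avg (cube I) (\<lambda>b'. avg I (\<lambda>i. hit i (alice_cells d b) (bob_cells d b')))))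
        \<le> avg ?D (\<lambda>d. avg (cube I) (\<lambda>b. avg (cube I) (\<lambda>b'. \<mu>)))"
      by (intro avg_mono avg_hit_le m I)
    then show "avg ?D (\<lambda>d. avg (cube I) (\<lambda>b. avg (cube I) (\<lambda>b'. avg I (\<lambda>i. hit i (alice_cells d b) (bob_cells d b'))))) \<le> \<mu>"
      unfolding avg_cube_const avg_const[OF finD] .
    have "avg I (\<lambda>i. edge d i (d i)) \<le> 4 * ln (real (card W)) / ?m" for d
      using sum_edge_le[of d] pos by (simp add: avg_def divide_right_mono)
    then have "avg ?D (\<lambda>d. avg I (\<lambda>i. edge d i (d i))) \<le> avg ?D (\<lambda>d. 4 * ln (real (card W)) / ?m)"
      by (intro avg_mono)
    then show "avg ?D (\<lambda>d. avg I (\<lambda>i. edge d i (d i))) \<le> 4 * ln (real (card W)) / ?m"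
      using finD by (simp add: avg_const)
  qed (use l in auto)
  finally show ?thesis by simp
qed

end

section \<open>Protocols\<close>

primrec leaves :: "('x, 'y, 'o) protocol \<Rightarrow> bool list set" where
  "leaves (Alice_Output g) = {[]}"
| "leaves (Bob_Output g) = {[]}"
| "leaves (Alice_Sends s \<pi>0 \<pi>1) = Cons False ` leaves \<pi>0 \<union> Cons True ` leaves \<pi>1"
| "leaves (Bob_Sends s \<pi>0 \<pi>1) = Cons False ` leaves \<pi>0 \<union> Cons True ` leaves \<pi>1"

primrec leaf :: "('x, 'y, 'o) protocol \<Rightarrow> bool list \<Rightarrow> ('x, 'y, 'o) protocol" where
  "leaf (Alice_Output g) w = Alice_Output g"
| "leaf (Bob_Output g) w = Bob_Output g"
| "leaf (Alice_Sends s \<pi>0 \<pi>1) w = (if hd w then leaf \<pi>1 (tl w) else leaf \<pi>0 (tl w))"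
| "leaf (Bob_Sends s \<pi>0 \<pi>1) w = (if hd w then leaf \<pi>1 (tl w) else leaf \<pi>0 (tl w))"

text \<open>A leaf is named by the bits sent on the way to it. \<open>follows_A\<close> and
  \<open>follows_B\<close> each check the bits of one player only, so together they cut out the
  rectangle of inputs that reach the leaf.\<close>

primrec follows_A :: "('x, 'y, 'o) protocol \<Rightarrow> bool list \<Rightarrow> 'x \<Rightarrow> bool" where
  "follows_A (Alice_Output g) w x \<longleftrightarrow> True"
| "follows_A (Bob_Output g) w x \<longleftrightarrow> True"
| "follows_A (Alice_Sends s \<pi>0 \<pi>1) w x \<longleftrightarrow>
     s x = hd w \<and> (if hd w then follows_A \<pi>1 (tl w) x else follows_A \<pi>0 (tl w) x)"
| "follows_A (Bob_Sends s \<pi>0 \<pi>1) w x \<longleftrightarrow> (if hd w then follows_A \<pi>1 (tl w) x else follows_A \<pi>0 (tl w) x)"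

primrec follows_B :: "('x, 'y, 'o) protocol \<Rightarrow> bool list \<Rightarrow> 'y \<Rightarrow> bool" where
  "follows_B (Alice_Output g) w y \<longleftrightarrow> True"
| "follows_B (Bob_Output g) w y \<longleftrightarrow> True"
| "follows_B (Alice_Sends s \<pi>0 \<pi>1) w y \<longleftrightarrow> (if hd w then follows_B \<pi>1 (tl w) y else follows_B \<pi>0 (tl w) y)"
| "follows_B (Bob_Sends s \<pi>0 \<pi>1) w y \<longleftrightarrow>
     s y = hd w \<and> (if hd w then follows_B \<pi>1 (tl w) y else follows_B \<pi>0 (tl w) y)"

lemma finite_leaves: "finite (leaves \<pi>)"
  by (induction \<pi>) auto

lemma card_leaves: "card (leaves \<pi>) \<le> 2 ^ bits \<pi>"
  for \<pi> :: "('x, 'y, 'o) protocol"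
proof -
  have step: "card (Cons False ` leaves \<pi>0 \<union> Cons True ` leaves \<pi>1) \<le> 2 * 2 ^ max (bits \<pi>0) (bits \<pi>1)"
    if "card (leaves \<pi>0) \<le> 2 ^ bits \<pi>0" "card (leaves \<pi>1) \<le> 2 ^ bits \<pi>1"
    for \<pi>0 \<pi>1 :: "('x, 'y, 'o) protocol"
  proof -
    have "card (Cons False ` leaves \<pi>0 \<union> Cons True ` leaves \<pi>1)
        \<le> card (Cons False ` leaves \<pi>0) + card (Cons True ` leaves \<pi>1)"
      by (rule card_Un_le)
    also have "\<dots> = card (leaves \<pi>0) + card (leaves \<pi>1)"
      by (simp add: card_image)
    also have "\<dots> \<le> 2 ^ max (bits \<pi>0) (bits \<pi>1) + 2 ^ max (bits \<pi>0) (bits \<pi>1)"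
      using that by (intro add_mono order_trans[OF that(1)] order_trans[OF that(2)] power_increasing) auto
    finally show ?thesis by simp
  qed
  show ?thesis by (induction \<pi>) (simp_all add: step)
qed

lemma sum_leaves:
  "(\<Sum>w\<in>leaves \<pi>. of_bool (follows_A \<pi> w x) * of_bool (follows_B \<pi> w y)) = (1 :: real)"
  for \<pi> :: "('x, 'y, 'o) protocol"
proof -
  have split: "(\<Sum>w\<in>Cons False ` leaves \<pi>0 \<union> Cons True ` leaves \<pi>1. F w)
      = (\<Sum>w\<in>leaves \<pi>0. F (False # w)) + (\<Sum>w\<in>leaves \<pi>1. F (True # w))"
    for F :: "bool list \<Rightarrow> real" and \<pi>0 \<pi>1 :: "('x, 'y, 'o) protocol"
    by (subst sum.union_disjoint) (auto simp: finite_leaves sum.reindex)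
  show ?thesis
  proof (induction \<pi>)
    case (Alice_Sends s \<pi>0 \<pi>1)
    then show ?case by (cases "s x") (simp_all add: split)
  next
    case (Bob_Sends s \<pi>0 \<pi>1)
    then show ?case by (cases "s y") (simp_all add: split)
  qed auto
qed

lemma run_eq_run_leaf:
  "w \<in> leaves \<pi> \<Longrightarrow> follows_A \<pi> w x \<Longrightarrow> follows_B \<pi> w y \<Longrightarrow> run \<pi> x y = run (leaf \<pi> w) x y"
  by (induction \<pi> arbitrary: w; auto split: if_splits; blast)

lemma leaf_is_output:
  "w \<in> leaves \<pi> \<Longrightarrow> (\<exists>g. leaf \<pi> w = Alice_Output g) \<or> (\<exists>g. leaf \<pi> w = Bob_Output g)"
  by (induction \<pi> arbitrary: w; auto split: if_splits; blast)

lemma protocol_planted_success_le: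
  fixes \<pi> :: "('x, 'y, 'o) protocol" and X :: "('i \<Rightarrow> nat) \<Rightarrow> 'x" and Y :: "('i \<Rightarrow> nat) \<Rightarrow> 'y"
    and label :: "'o \<Rightarrow> 'c" and colour :: "'i \<Rightarrow> 'c"
  assumes I: "finite I" "I \<noteq> {}"
    and m: "\<And>c. real (card {i \<in> I. colour i = c}) \<le> \<mu> * real (card I)"
    and l: "l > 0" and K: "2 * B \<le> K" "K > 0"
  shows "avg (PiE I (\<lambda>_. {..<K})) (\<lambda>d. avg I (\<lambda>i. avg {0, 1} (\<lambda>v. avg (cube I) (\<lambda>b. avg (cube I) (\<lambda>b'.
      of_bool (label (run \<pi> (X ((alice_cells d b)(i := (d i + v) div 2)))
        (Y ((bob_cells d b')(i := (d i + v + 1) div 2 + B)))) = colour i))))))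
    \<le> \<mu> + 4 * l + 2 * real B / real K + 32 * (real B)\<^sup>2 * real (bits \<pi>) / (l * real (card I))"
proof -
  define W where "W = leaves \<pi>"
  define WA where "WA = {w \<in> W. \<exists>g. leaf \<pi> w = Alice_Output g}"
  define WB where "WB = W - WA"
  define S where "S w x = (of_bool (follows_A \<pi> w (X x)) :: real)" for w x
  define T where "T w y = (of_bool (follows_B \<pi> w (Y y)) :: real)" for w y
  \<comment> \<open>At a leaf where Alice announces, \<open>run\<close> ignores Bob's input, so any
    value can stand for it; likewise for \<open>cB\<close>.\<close>
  define cA where "cA w x = label (run (leaf \<pi> w) (X x) undefined)" for w x
  define cB where "cB w y = label (run (leaf \<pi> w) undefined (Y y))" for w y
  interpret labelled_partition I W S T WA WB cA cB colour
    by unfold_locales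
      (auto simp: W_def S_def T_def WA_def WB_def I finite_leaves sum_leaves)
  have runA: "label (run \<pi> (X x) (Y y)) = cA w x" if "w \<in> WA" "S w x \<noteq> 0" "T w y \<noteq> 0" for w x y
    using that run_eq_run_leaf[of w \<pi> "X x" "Y y"] by (auto simp: WA_def W_def S_def T_def cA_def)
  have runB: "label (run \<pi> (X x) (Y y)) = cB w y" if "w \<in> WB" "S w x \<noteq> 0" "T w y \<noteq> 0" for w x y
    using that run_eq_run_leaf[of w \<pi> "X x" "Y y"] leaf_is_output[of w \<pi>]
    by (auto simp: WB_def WA_def W_def S_def T_def cB_def)
  have hit: "hit i x y = of_bool (label (run \<pi> (X x) (Y y)) = colour i)" for i x y
  proof -
    have "hit i x y = (\<Sum>w\<in>WA. S w x * T w y * of_bool (label (run \<pi> (X x) (Y y)) = colour i))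
        + (\<Sum>w\<in>WB. S w x * T w y * of_bool (label (run \<pi> (X x) (Y y)) = colour i))"
      unfolding hit_def
    proof (intro arg_cong2[where f = "(+)"] sum.cong refl)
      fix w assume "w \<in> WA"
      then show "S w x * T w y * of_bool (cA w x = colour i)
          = S w x * T w y * of_bool (label (run \<pi> (X x) (Y y)) = colour i)"
        using runA[of w x y] by (cases "S w x = 0 \<or> T w y = 0") auto
    next
      fix w assume "w \<in> WB"
      then show "S w x * T w y * of_bool (cB w y = colour i)
          = S w x * T w y * of_bool (label (run \<pi> (X x) (Y y)) = colour i)"
        using runB[of w x y] by (cases "S w x = 0 \<or> T w y = 0") auto
    qed
    also have "\<dots> = (\<Sum>w\<in>W. S w x * T w y) * of_bool (label (run \<pi> (X x) (Y y)) = colour i)"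
      unfolding WA_WB(1) sum_distrib_right using finite_WA_WB WA_WB(2) by (simp add: sum.union_disjoint)
    finally show ?thesis by (simp add: partition)
  qed
  have "ln (real (card W)) \<le> ln (2 ^ bits \<pi>)"
  proof (subst ln_le_cancel_iff)
    show "0 < real (card W)" using partition[of undefined undefined] finite_W by (auto simp: card_gt_0_iff)
    show "real (card W) \<le> 2 ^ bits \<pi>"
      unfolding W_def using card_leaves[of \<pi>] by (metis of_nat_le_iff of_nat_numeral of_nat_power)
  qed simp
  also have "\<dots> \<le> real (bits \<pi>) * 1"
    unfolding ln_realpow by (intro mult_left_mono) (use ln_le_minus_one[of 2] in auto)
  finally have ln: "ln (real (card W)) \<le> real (bits \<pi>)" by simp
  have "32 * (real B)\<^sup>2 * ln (real (card W)) / (l * real (card I))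
      \<le> 32 * (real B)\<^sup>2 * real (bits \<pi>) / (l * real (card I))"
    using l ln by (intro divide_right_mono mult_left_mono) auto
  then show ?thesis
    using avg_planted_hit_le[OF m I(2) l K] unfolding hit_avg_def hit by linarith
qed

section \<open>From random coins to a deterministic protocol\<close>

lemma avg_Times: "avg (A \<times> B) (\<lambda>(a, b). F a b) = avg A (\<lambda>a. avg B (F a))"
  unfolding avg_def by (simp add: sum.cartesian_product[symmetric] sum_divide_distrib[symmetric] card_cartesian_product mult.commute)

text \<open>The easy direction of Yao's principle: exchange the expectation over the coins with the
  average over the inputs.\<close>

lemma (in prob_space) exists_avg_ge_of_prob_ge:
  assumes fin: "finite A" "A \<noteq> {}" and q: "q > 0"
    and ok: "\<And>a. a \<in> A \<Longrightarrow> q \<le> prob {x \<in> space M. ok x a}"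
  shows "\<exists>x\<in>space M. q \<le> avg A (\<lambda>a. of_bool (ok x a))"
proof (rule ccontr)
  assume "\<not> ?thesis"
  then have less: "avg A (\<lambda>a. of_bool (ok x a)) < q" if "x \<in> space M" for x using that by force
  \<comment> \<open>A non-measurable event would have measure 0, which is less than
    \<open>q\<close>.\<close>
  have sets: "{x \<in> space M. ok x a} \<in> events" if "a \<in> A" for a
    using ok[OF that] q measure_notin_sets by fastforce
  let ?f = "\<lambda>x. avg A (\<lambda>a. indicator {x \<in> space M. ok x a} x)"
  have ind: "integrable M (indicat_real {x \<in> space M. ok x a})" if "a \<in> A" for a
    using sets[OF that] by (intro integrable_real_indicator) (auto simp: less_top[symmetric])
  have int: "integrable M ?f"
    unfolding avg_def by (intro integrable_divide Bochner_Integration.integrable_sum ind)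
  have "expectation ?f = (\<Sum>a\<in>A. expectation (indicat_real {x \<in> space M. ok x a})) / real (card A)"
    unfolding avg_def by (subst integral_divide_zero, subst Bochner_Integration.integral_sum) (auto intro: ind)
  also have "\<dots> = avg A (\<lambda>a. prob {x \<in> space M. ok x a})"
    unfolding avg_def using sets by (simp cong: sum.cong)
  finally have "expectation ?f = avg A (\<lambda>a. prob {x \<in> space M. ok x a})" .
  moreover have "q \<le> avg A (\<lambda>a. prob {x \<in> space M. ok x a})"
    using avg_mono[of A "\<lambda>_. q"] ok by (simp add: avg_const[OF fin])
  moreover have "expectation ?f < q"
  proof (rule expectation_less[OF int])
    show "AE x in M. ?f x < q"
      using less by (intro AE_I2) (simp add: indicator_def of_bool_def)
  qed
  ultimately show False by simp
qed

section \<open>The hard distribution\<close>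

text \<open>The first \<open>k\<close> diagonal entries are large whatever the remaining input is; they use up
  all but one of the dimensions of the row space of the projection.\<close>

definition alice_mat :: "nat \<Rightarrow> nat \<Rightarrow> nat \<Rightarrow> nat \<Rightarrow> (nat \<times> nat \<Rightarrow> nat) \<Rightarrow> real mat" where
  "alice_mat n d k B x = mat n d (\<lambda>(r, c). if k \<le> r \<and> k \<le> c then real (x (r, c))
     else if r = c then - real B else 0)"

definition bob_mat :: "nat \<Rightarrow> nat \<Rightarrow> nat \<Rightarrow> (nat \<times> nat \<Rightarrow> nat) \<Rightarrow> real mat" where
  "bob_mat n d k y = mat n d (\<lambda>(r, c). if k \<le> r \<and> k \<le> c then - real (y (r, c)) else 0)"

lemma alice_cells_minus_yv:
  assumes "b i \<in> {0, 1}" "b' i \<in> {0, 1}"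
  shows "real (alice_cells e b i) - real (bob_cells e b' i) \<in> {0, - 1}"
proof -
  have "b i = 0 \<or> b i = 1" "b' i = 0 \<or> b' i = 1" using assms by auto
  then have "bob_cells e b' i = alice_cells e b i \<or> bob_cells e b' i = alice_cells e b i + 1"
    unfolding alice_cells_def bob_cells_def by presburger
  then show ?thesis by auto
qed

text \<open>The assumptions on \<open>f\<close> cover every difference that occurs: \<open>0\<close>
  and \<open>- 1\<close> in the background, \<open>- B\<close> on the fixed diagonal, and
  \<open>- B\<close> or \<open>- B - 1\<close> in the planted cell. In the application
  \<open>k\<close> is one less than the rank.\<close>

lemma implicit_mat_spiked:
  fixes f :: "real \<Rightarrow> real"
  assumes ij: "k \<le> r" "r < n" "k \<le> c" "c < d" and kn: "k \<le> n"
    and b: "b \<in> cube ({k..<n} \<times> {k..<d})" "b' \<in> cube ({k..<n} \<times> {k..<d})" and v: "v \<in> {0, 1}"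
    and f: "\<bar>f 0\<bar> \<le> M" "\<bar>f (- 1)\<bar> \<le> M" "H \<le> \<bar>f (- real B)\<bar>" "H \<le> \<bar>f (- real B - 1)\<bar>"
  shows "spiked n d H M (insert c {..<k}) (\<lambda>j. if j < k then j else r)
    (implicit_mat f (alice_mat n d k B ((alice_cells e b)((r, c) := (e (r, c) + v) div 2)))
      (bob_mat n d k ((bob_cells e b')((r, c) := (e (r, c) + v + 1) div 2 + B))))"
    (is "spiked n d H M ?C ?\<rho> (implicit_mat f (alice_mat n d k B ?x) (bob_mat n d k ?y))")
proof -
  let ?A = "implicit_mat f (alice_mat n d k B ?x) (bob_mat n d k ?y)"
  have A: "?A $$ (i, j) = (if k \<le> i \<and> k \<le> j then f (real (?x (i, j)) - real (?y (i, j)))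
      else if i = j then f (- real B) else f 0)" if "i < n" "j < d" for i j
    using that by (simp add: implicit_mat_def alice_mat_def bob_mat_def)
  have spike: "real (?x (r, c)) - real (?y (r, c)) \<in> {- real B, - real B - 1}"
    using v by (cases "even (e (r, c))") (auto elim!: evenE oddE)
  have "H \<le> \<bar>f (real (?x (r, c)) - real (?y (r, c)))\<bar>"
    using spike f(3,4) by (metis insertE singletonD)
  note spike = this
  have rest: "\<bar>f (real (?x (i, j)) - real (?y (i, j)))\<bar> \<le> M"
    if "k \<le> i" "i < n" "k \<le> j" "j < d" "(i, j) \<noteq> (r, c)" for i j
  proof -
    have "b (i, j) \<in> {0, 1}" "b' (i, j) \<in> {0, 1}" using b that(1-4) by (auto simp: PiE_iff)
    from alice_cells_minus_yv[of b "(i, j)" b', OF this, of e] show ?thesis using f(1,2) that(5) by auto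
  qed
  show ?thesis
    unfolding spiked_def
  proof (intro conjI allI impI)
    show "?A \<in> carrier_mat n d" by (simp add: implicit_mat_def alice_mat_def)
    show "?C \<subseteq> {..<d}" using ij by auto
    show "inj_on ?\<rho> ?C" using ij by (auto simp: inj_on_def)
    show "?\<rho> ` ?C \<subseteq> {..<n}" using ij kn by auto
    fix i j assume i: "i < n" and j: "j < d"
    show "if j \<in> ?C \<and> i = ?\<rho> j then H \<le> \<bar>?A $$ (i, j)\<bar> else \<bar>?A $$ (i, j)\<bar> \<le> M"
    proof (cases "k \<le> i \<and> k \<le> j")
      case True
      show ?thesis
      proof (cases "(i, j) = (r, c)")
        case True
        then show ?thesis using spike ij unfolding A[OF i j] by (simp del: fun_upd_apply)
      next
        case False
        with True show ?thesis using rest[of i j] i j unfolding A[OF i j] by auto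
      qed
    next
      case False
      \<comment> \<open>The planted row and column are at least \<open>k\<close>, so outside the
        block the spikes are exactly the diagonal entries.\<close>
      then have iff: "j \<in> ?C \<and> i = ?\<rho> j \<longleftrightarrow> i = j" using ij by (auto split: if_splits)
      have Aij: "?A $$ (i, j) = (if i = j then f (- real B) else f 0)"
        by (simp only: A[OF i j] False if_False)
      then show ?thesis unfolding iff Aij using f(1,3) by simp
    qed
  qed
qed

text \<open>Averaging over the coins yields one deterministic protocol that succeeds on a fraction
  \<open>q\<close> of the hard inputs. Its output reveals the planted column by
  \<open>spiked_columns_unique\<close>, so the bound on planted hits applies to it.\<close>

lemma computes_low_rank_bound:
  fixes f :: "real \<Rightarrow> real" and D :: "(real mat \<times> real mat) set"
  assumes k: "k \<ge> 1" "k < d" "d \<le> n" and \<epsilon>: "\<epsilon> > 0" and q: "q > 0"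
    and f: "\<bar>f 0\<bar> \<le> M" "\<bar>f (- 1)\<bar> \<le> M" "H \<le> \<bar>f (- real B)\<bar>" "H \<le> \<bar>f (- real B - 1)\<bar>"
    and H: "H > real (Suc k) * (sqrt ((1 + \<epsilon>) * real n * real d) * M + M)"
    and l: "l > 0" and K: "2 * B \<le> K" "K > 0" and L: "real K + 2 + real B \<le> L"
    and D: "admissible_inputs n d L D"
    and comp: "computes_low_rank f k \<epsilon> q D N" and t: "\<forall>\<pi>\<in>space N. bits \<pi> \<le> t"
  shows "q \<le> 1 / 2 + 4 * l + 2 * real B / real K
    + 32 * (real B)\<^sup>2 * real t / (l * (real (n - (k - 1)) * real (d - (k - 1))))"
proof -
  \<comment> \<open>The \<open>k - 1\<close> fixed spikes and the planted one make \<open>k\<close>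
    spike columns in all.\<close>
  define k' where "k' = k - 1"
  have k': "Suc k' = k" "k' < n" "k' < d" using k by (auto simp: k'_def)
  define I where "I = {k'..<n} \<times> {k'..<d}"
  have I: "finite I" "I \<noteq> {}" using k' by (auto simp: I_def)
  have cardI: "card I = (n - k') * (d - k')" by (simp add: I_def)
  define P where "P = PiE I (\<lambda>_. {..<K})"
  have finP: "finite P" "P \<noteq> {}" using I K by (auto simp: P_def finite_PiE PiE_eq_empty_iff)
  \<comment> \<open>A sample consists of the edges, the planted cell, the end of the edge taken
    there, and the bits of Alice and of Bob.\<close>
  define \<Omega> where "\<Omega> = P \<times> I \<times> {0, 1 :: nat} \<times> cube I \<times> cube I"
  have fin\<Omega>: "finite \<Omega>" "\<Omega> \<noteq> {}"
    using finP I finite_cube[OF I(1)] cube_nonempty[of I] by (auto simp: \<Omega>_def)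
  define X where "X e i v b = alice_mat n d k' B ((alice_cells e b)(i := (e i + v) div 2))" for e i v b
  define Y where "Y e i v b = bob_mat n d k' ((bob_cells e b)(i := (e i + v + 1) div 2 + B))" for e i v b
  define good where "good Q c \<longleftrightarrow> k' \<le> c \<and> (\<exists>A \<rho>. spiked n d H M (insert c {..<k'}) \<rho> A \<and> low_rank_solution k \<epsilon> A Q)"
    for Q c
  \<comment> \<open>The planted column read off from the output \<open>Q\<close>; there is at most
    one candidate, as shown next.\<close>
  define label where "label Q = (SOME c. good Q c)" for Q
  have M: "M \<ge> 0" using f(1) by linarith
  have label: "label Q = c" if "good Q c" for Q c
  proof -
    have "good Q (label Q)" unfolding label_def using that by (rule someI)
    moreover have "c' = c" if "good Q c" "good Q c'" for c c'
    proof -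
      have "insert c {..<k'} = insert c' {..<k'}"
        using that spiked_columns_unique[OF _ _ _ _ _ _ M less_imp_le[OF \<epsilon>] H] k'(1)
        unfolding good_def by (metis card_insert_disjoint card_lessThan finite_lessThan leD lessThan_iff)
      then show ?thesis using that unfolding good_def by (metis insert_iff leD lessThan_iff)
    qed
    ultimately show ?thesis using that by blast
  qed
  have solved: "label Q = snd i"
    if prems: "low_rank_solution k \<epsilon> (implicit_mat f (X e i v b) (Y e i v b')) Q"
      "i \<in> I" "v \<in> {0, 1}" "b \<in> cube I" "b' \<in> cube I" for Q e i v b b'
  proof (rule label)
    obtain r c where i: "i = (r, c)" "k' \<le> r" "r < n" "k' \<le> c" "c < d"
      using prems(2) by (auto simp: I_def)
    show "good Q (snd i)"
      using implicit_mat_spiked[OF i(2-5) less_imp_le[OF k'(2)] _ _ prems(3) f, of b b' e] prems i(4)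
      unfolding good_def X_def Y_def i(1) I_def by auto
  qed
  have in_D: "(X e i v b, Y e i v b') \<in> D"
    if e: "e \<in> P" and i: "i \<in> I" and v: "v \<in> {0, 1}" and b: "b \<in> cube I" "b' \<in> cube I" for e i v b b'
  proof -
    have lim: "alice_cells e b j \<le> K" "bob_cells e b' j \<le> K + 1" if "j \<in> I" for j
    proof -
      have "e j < K" "b j \<le> 1" "b' j \<le> 1" using e b that by (auto simp: P_def PiE_iff)
      then show "alice_cells e b j \<le> K" "bob_cells e b' j \<le> K + 1" by (auto simp: alice_cells_def bob_cells_def)
    qed
    have "e i < K" "v \<le> 1" using e i v by (auto simp: P_def PiE_iff)
    then have limi: "(e i + v) div 2 \<le> K" "(e i + v + 1) div 2 + B \<le> K + 1 + B" by auto
    have x: "((alice_cells e b)(i := (e i + v) div 2)) j \<le> K" if "j \<in> I" for j using lim(1)[OF that] limi(1) by simp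
    have y: "((bob_cells e b')(i := (e i + v + 1) div 2 + B)) j \<le> K + 1 + B" if "j \<in> I" for j
      using lim(2)[OF that] limi(2) by simp
    have xL: "real (((alice_cells e b)(i := (e i + v) div 2)) j) \<le> L"
      and yL: "real (((bob_cells e b')(i := (e i + v + 1) div 2 + B)) j) \<le> L" if "j \<in> I" for j
      using x[OF that] y[OF that] L by linarith+
    have "X e i v b \<in> bounded_int_mats n d L" "Y e i v b' \<in> bounded_int_mats n d L"
      using L xL yL unfolding bounded_int_mats_def X_def Y_def alice_mat_def bob_mat_def I_def
      by (auto simp del: fun_upd_apply)
    then show ?thesis using D by (auto simp: admissible_inputs_def)
  qed
  interpret prob_space N using comp by (simp add: computes_low_rank_def)
  define ok where "ok \<pi> = (\<lambda>(e, i, v, b, b').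
      low_rank_solution k \<epsilon> (implicit_mat f (X e i v b) (Y e i v b')) (run \<pi> (X e i v b) (Y e i v b')))" for \<pi>
  have "q \<le> prob {\<pi> \<in> space N. ok \<pi> \<omega>}" if "\<omega> \<in> \<Omega>" for \<omega>
  proof -
    obtain e i v b b' where \<omega>: "\<omega> = (e, i, v, b, b')" by (metis prod_cases5)
    then have "e \<in> P" "i \<in> I" "v \<in> {0, 1}" "b \<in> cube I" "b' \<in> cube I"
      using that unfolding \<Omega>_def by simp_all
    from in_D[OF this] show ?thesis using comp by (auto simp: computes_low_rank_def ok_def \<omega>)
  qed
  from exists_avg_ge_of_prob_ge[where ok = ok, OF fin\<Omega> q this]
  obtain \<pi> where \<pi>: "\<pi> \<in> space N" "q \<le> avg \<Omega> (\<lambda>\<omega>. of_bool (ok \<pi> \<omega>))" by blast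
  define F where "F e i v b b' = (of_bool (label (run \<pi> (X e i v b) (Y e i v b')) = snd i) :: real)" for e i v b b'
  have "avg \<Omega> (\<lambda>\<omega>. of_bool (ok \<pi> \<omega>)) \<le> avg \<Omega> (\<lambda>(e, i, v, b, b'). F e i v b b')"
  proof (rule avg_mono)
    fix \<omega> assume "\<omega> \<in> \<Omega>"
    obtain e i v b b' where \<omega>: "\<omega> = (e, i, v, b, b')" by (metis prod_cases5)
    with \<open>\<omega> \<in> \<Omega>\<close> have mem: "i \<in> I" "v \<in> {0, 1}" "b \<in> cube I" "b' \<in> cube I"
      unfolding \<Omega>_def by simp_all
    show "of_bool (ok \<pi> \<omega>) \<le> (case \<omega> of (e, i, v, b, b') \<Rightarrow> F e i v b b')"
      using solved[OF _ mem] by (auto simp: \<omega> ok_def F_def)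
  qed
  also have "\<dots> = avg P (\<lambda>e. avg I (\<lambda>i. avg {0, 1} (\<lambda>v. avg (cube I) (\<lambda>b. avg (cube I) (\<lambda>b'. F e i v b b')))))"
    unfolding \<Omega>_def avg_Times ..
  also have "\<dots> \<le> 1 / real (d - k') + 4 * l + 2 * real B / real K + 32 * (real B)\<^sup>2 * real (bits \<pi>) / (l * real (card I))"
    unfolding F_def X_def Y_def P_def
  proof (rule protocol_planted_success_le[OF I _ l K])
    fix c
    \<comment> \<open>The colour classes are the columns of the block.\<close>
    have "{i \<in> I. snd i = c} \<subseteq> {k'..<n} \<times> {c}" by (auto simp: I_def)
    then have "card {i \<in> I. snd i = c} \<le> card ({k'..<n} \<times> {c})" by (intro card_mono) auto
    also have "\<dots> = n - k'" by simp
    finally have "real (card {i \<in> I. snd i = c}) \<le> real (n - k')" by simp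
    also have "\<dots> = 1 / real (d - k') * real (card I)" using k'(3) by (simp add: cardI)
    finally show "real (card {i \<in> I. snd i = c}) \<le> 1 / real (d - k') * real (card I)" .
  qed
  also have "\<dots> \<le> 1 / 2 + 4 * l + 2 * real B / real K + 32 * (real B)\<^sup>2 * real t / (l * real (card I))"
  proof (intro add_mono order_refl divide_right_mono mult_left_mono)
    \<comment> \<open>Because of \<open>k < d\<close> the block has at least two columns, so a blind
      guess succeeds with probability at most \<open>1 / 2\<close>.\<close>
    have "d - k' \<ge> 2" using k k'(1) by linarith
    then show "1 / real (d - k') \<le> 1 / 2" by (intro divide_left_mono) auto
    show "real (bits \<pi>) \<le> real t" using t \<pi>(1) by simp
  qed (use l in auto)
  finally show ?thesis using \<pi>(2) by (simp add: cardI k'_def)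
qed

section \<open>Choice of parameters\<close>

text \<open>This inverts the growth condition: values above \<open>M * y\<close> are reached at
  arguments of order \<open>y powr (1 / p)\<close>. In \<open>C\<close>, \<open>x0\<close> ensures
  that the growth bound applies, and the summand 1 in \<open>M / c1 + 1\<close> makes the conclusion
  strict.\<close>

lemma two_scale_constants:
  fixes f :: "real \<Rightarrow> real"
  assumes f: "f \<in> \<Omega>[at_infinity](\<lambda>x. \<bar>x\<bar> powr p)" and p: "p > 0" and M: "M \<ge> 0"
  shows "\<exists>C\<ge>1. \<forall>y\<ge>1. \<forall>x. \<bar>x\<bar> \<ge> C * y powr (1 / p) \<longrightarrow> \<bar>f x\<bar> > M * y"
proof -
  from f obtain c1 where c1: "c1 > 0" "\<forall>\<^sub>F x in at_infinity. norm (f x) \<ge> c1 * norm (\<bar>x\<bar> powr p)"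
    by (auto elim!: landau_omega.bigE)
  then obtain x0 where x0: "\<And>x. x0 \<le> \<bar>x\<bar> \<Longrightarrow> \<bar>f x\<bar> \<ge> c1 * \<bar>x\<bar> powr p"
    by (auto simp: eventually_at_infinity)
  define C where "C = max 1 (max x0 ((M / c1 + 1) powr (1 / p)))"
  have C: "C \<ge> 1" "C \<ge> x0" "C \<ge> (M / c1 + 1) powr (1 / p)" by (auto simp: C_def)
  have "\<bar>f x\<bar> > M * y" if y: "y \<ge> 1" and x: "\<bar>x\<bar> \<ge> C * y powr (1 / p)" for x y
  proof -
    have y1: "y powr (1 / p) \<ge> 1" using y p by (simp add: ge_one_powr_ge_zero)
    then have "C * 1 \<le> C * y powr (1 / p)" using C(1) by (intro mult_left_mono) auto
    then have "x0 \<le> \<bar>x\<bar>" using C(2) x by linarith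
    have "(M / c1 + 1) * y = ((M / c1 + 1) powr (1 / p)) powr p * (y powr (1 / p)) powr p"
      using p M c1(1) y by (simp add: powr_powr)
    also have "\<dots> = ((M / c1 + 1) powr (1 / p) * y powr (1 / p)) powr p" by (simp add: powr_mult)
    also have "\<dots> \<le> (C * y powr (1 / p)) powr p"
      using C(3) p by (intro powr_mono2 mult_right_mono) auto
    also have "\<dots> \<le> \<bar>x\<bar> powr p" using x p C(1) by (intro powr_mono2) auto
    finally have "c1 * ((M / c1 + 1) * y) \<le> c1 * \<bar>x\<bar> powr p" using c1(1) by (intro mult_left_mono) auto
    also have "\<dots> \<le> \<bar>f x\<bar>" using x0[OF \<open>x0 \<le> \<bar>x\<bar>\<close>] .
    also have "c1 * ((M / c1 + 1) * y) = M * y + c1 * y" using c1(1) by (simp add: field_simps)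
    finally have "M * y + c1 * y \<le> \<bar>f x\<bar>" .
    then show ?thesis using c1(1) y by (smt (verit) mult_pos_pos)
  qed
  then show ?thesis using C(1) by blast
qed

text \<open>Giving up \<open>k - 1\<close> rows or columns to the fixed spikes costs at most a
  factor \<open>k\<close>, which is absorbed into the constant.\<close>

lemma real_le_mult_diff_pred:
  assumes "1 \<le> k" "k \<le> n"
  shows "real n \<le> real k * real (n - (k - 1))"
proof -
  obtain k' j where k: "k = Suc k'" and n: "n = k + j" using assms by (metis le_Suc_ex Suc_le_D One_nat_def)
  have "n \<le> k * (n - (k - 1))" unfolding n k by simp
  then show ?thesis by (metis of_nat_le_iff of_nat_mult)
qed

theorem theorem4:
  fixes f :: "real \<Rightarrow> real" and p q :: real and k :: nat
  assumes "f \<in> \<Omega>[at_infinity](\<lambda>x. \<bar>x\<bar> powr p)"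
    and "p > 1"
    and "k \<ge> 1"
    and "q > 1 / 2"
  shows "\<exists>c>0. \<exists>a b :: nat. \<forall>(n :: nat) (d :: nat) (\<epsilon> :: real) D M (t :: nat).
    k < d \<longrightarrow> d \<le> n \<longrightarrow> \<epsilon> > 0 \<longrightarrow>
    admissible_inputs n d (((1 + \<epsilon>) * real n * real d) ^ b) D \<longrightarrow>
    computes_low_rank f k \<epsilon> q D M \<longrightarrow>
    (\<forall>\<pi> \<in> space M. bits \<pi> \<le> t) \<longrightarrow>
    real t \<ge> c * ((1 + \<epsilon>) powr (- (2 / p)) * real n powr (1 - 1 / p) * real d powr (1 - 4 / p))
                / ln (real n * real d) ^ a"
proof -
  \<comment> \<open>\<open>M0\<close> bounds the background. With the factor in \<open>M1\<close>,
    the spike threshold of \<open>computes_low_rank_bound\<close> is at most \<open>M1 * y\<close>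
    for every \<open>y\<close> that is at least 1 and at least
    \<open>sqrt ((1 + \<epsilon>) * n * d)\<close>.\<close>
  define M0 where "M0 = max \<bar>f 0\<bar> \<bar>f (- 1)\<bar>"
  define M1 where "M1 = 2 * real (Suc k) * M0"
  have M: "M0 \<ge> 0" "M1 \<ge> 0" by (auto simp: M0_def M1_def)
  obtain C where C: "C \<ge> 1"
    "\<And>y x. y \<ge> 1 \<Longrightarrow> \<bar>x\<bar> \<ge> C * y powr (1 / p) \<Longrightarrow> \<bar>f x\<bar> > M1 * y"
    using two_scale_constants[OF assms(1) _ M(2)] assms(2) by auto
  define g where "g = q - 1 / 2"
  have g: "g > 0" using assms(4) by (simp add: g_def)
  \<comment> \<open>From \<open>K + 2 + B \<le> B * (8 / g + 6)\<close> and
    \<open>B \<le> 2 * (C * w\<^sup>2)\<close> below. As \<open>w \<ge> 2\<close>, the power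
    \<open>w ^ b'\<close> absorbs this constant.\<close>
  define C4 where "C4 = 2 * C * (8 / g + 6)"
  obtain b' where b': "C4 < 2 ^ b'" using real_arch_pow[of 2 C4] by auto
  \<comment> \<open>\<open>4096 * C\<^sup>2\<close> collects \<open>1024\<close> from the
    probability bound and \<open>4 * C\<^sup>2\<close> from \<open>B2\<close>; the square of
    \<open>k\<close> comes from \<open>nm\<close>.\<close>
  define c where "c = g\<^sup>2 / (4096 * C\<^sup>2 * (real k)\<^sup>2)"
  have c: "c > 0" using g C(1) assms(3) by (simp add: c_def)
  have main: "real t \<ge> c * ((1 + \<epsilon>) powr (- (2 / p)) * real n powr (1 - 1 / p) * real d powr (1 - 4 / p))"
    if kd: "k < d" "d \<le> n" and \<epsilon>: "\<epsilon> > 0"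
      and adm: "admissible_inputs n d (((1 + \<epsilon>) * real n * real d) ^ (2 + b')) D"
      and comp: "computes_low_rank f k \<epsilon> q D N" and t: "\<forall>\<pi> \<in> space N. bits \<pi> \<le> t"
    for n d \<epsilon> D N t
  proof -
    have nd: "real n \<ge> 2" "real d \<ge> 2" using kd assms(3) by auto
    \<comment> \<open>This \<open>y\<close> dominates the threshold
      \<open>sqrt ((1 + \<epsilon>) * n * d)\<close>, and \<open>n * d / y powr (2 / p)\<close> has
      exactly the exponents of the claim.\<close>
    define y where "y = (1 + \<epsilon>) * sqrt (real n) * (real d)\<^sup>2"
    define w where "w = (1 + \<epsilon>) * real n * real d"
    define z where "z = C * y powr (1 / p)"
    define B where "B = nat \<lceil>z\<rceil>"
    \<comment> \<open>\<open>2 * B / K\<close> and \<open>4 * l\<close> are each at most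
      \<open>g / 4\<close>, so the communication term has to supply the remaining
      \<open>g / 2\<close> of the advantage \<open>g\<close> over guessing.\<close>
    define K where "K = nat \<lceil>8 * real B / g\<rceil> + 2 * B"
    define l where "l = g / 16"
    define m where "m = real (n - (k - 1)) * real (d - (k - 1))"
    have d2: "(real d)\<^sup>2 \<ge> 1" using nd by simp
    have sq: "sqrt (real n) \<ge> 1" using nd by simp
    have s1: "sqrt ((1 + \<epsilon>) * real n * real d) \<le> y"
    proof (rule real_le_lsqrt)
      have "(1 + \<epsilon>) * (real n * real d) \<le> (1 + \<epsilon>)\<^sup>2 * (real n * (real d) ^ 4)"
      proof (intro mult_mono)
        show "1 + \<epsilon> \<le> (1 + \<epsilon>)\<^sup>2" using \<epsilon> by (simp add: power2_eq_square)
        show "real d \<le> (real d) ^ 4" using nd self_le_power[of "real d" 4] by simp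
      qed (use \<epsilon> in auto)
      also have "\<dots> = y\<^sup>2" by (simp add: y_def power_mult_distrib)
      finally show "(1 + \<epsilon>) * real n * real d \<le> y\<^sup>2" by (simp add: mult.assoc)
    qed (use \<epsilon> in \<open>auto simp: y_def\<close>)
    have y: "y \<ge> 1"
    proof -
      have "1 * 1 * 1 \<le> (1 + \<epsilon>) * sqrt (real n) * (real d)\<^sup>2"
        using \<epsilon> sq d2 by (intro mult_mono) auto
      then show ?thesis by (simp add: y_def)
    qed
    have w: "w \<ge> 2"
    proof -
      have "1 * 2 * 1 \<le> (1 + \<epsilon>) * real n * real d" using \<epsilon> nd by (intro mult_mono) auto
      then show ?thesis by (simp add: w_def)
    qed
    have yw: "y \<le> w\<^sup>2"
    proof -
      have "(1 + \<epsilon>) * sqrt (real n) * (real d)\<^sup>2 \<le> (1 + \<epsilon>)\<^sup>2 * (real n)\<^sup>2 * (real d)\<^sup>2"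
      proof (intro mult_mono)
        show "1 + \<epsilon> \<le> (1 + \<epsilon>)\<^sup>2" using \<epsilon> by (simp add: power2_eq_square)
        have "sqrt (real n) \<le> sqrt (real n) * sqrt (real n)"
          using mult_left_mono[OF sq, of "sqrt (real n)"] by simp
        also have "\<dots> \<le> (real n)\<^sup>2" using nd by (simp add: power2_eq_square)
        finally show "sqrt (real n) \<le> (real n)\<^sup>2" .
      qed (use \<epsilon> in auto)
      then show ?thesis by (simp add: y_def w_def power_mult_distrib)
    qed
    have yp1: "1 \<le> y powr (1 / p)" using y assms(2) by (simp add: ge_one_powr_ge_zero)
    have ypy: "y powr (1 / p) \<le> y" using y assms(2) powr_mono[of "1 / p" 1 y] by simp
    have z1: "z \<ge> 1"
    proof -
      have "1 * 1 \<le> C * y powr (1 / p)" using C(1) yp1 by (intro mult_mono) auto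
      then show ?thesis by (simp add: z_def)
    qed
    have Bz: "z \<le> real B" "real B \<le> 2 * z" "real B \<ge> 1" using z1 unfolding B_def by linarith+
    have "\<bar>f (- real B)\<bar> > M1 * y" "\<bar>f (- real B - 1)\<bar> > M1 * y"
      using C(2)[OF y] Bz(1) by (auto simp: z_def)
    moreover have "real (Suc k) * (sqrt ((1 + \<epsilon>) * real n * real d) * M0 + M0) \<le> M1 * y"
    proof -
      have "sqrt ((1 + \<epsilon>) * real n * real d) * M0 + 1 * M0 \<le> y * M0 + y * M0"
        using s1 y M(1) by (intro add_mono mult_right_mono) auto
      then have "real (Suc k) * (sqrt ((1 + \<epsilon>) * real n * real d) * M0 + M0) \<le> real (Suc k) * (y * M0 + y * M0)"
        by (intro mult_left_mono) auto
      then show ?thesis by (simp add: M1_def algebra_simps)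
    qed
    ultimately have H: "real (Suc k) * (sqrt ((1 + \<epsilon>) * real n * real d) * M0 + M0)
        < min \<bar>f (- real B)\<bar> \<bar>f (- real B - 1)\<bar>" by linarith
    have K: "2 * B \<le> K" "K > 0" "8 * real B / g \<le> real K" "real K \<le> 8 * real B / g + 1 + 2 * real B"
    proof -
      have "8 * real B / g > 0" using Bz g by simp
      then show "8 * real B / g \<le> real K" "real K \<le> 8 * real B / g + 1 + 2 * real B"
        unfolding K_def by linarith+
      show "2 * B \<le> K" by (simp add: K_def)
      then show "K > 0" using Bz(3) by linarith
    qed
    have L: "real K + 2 + real B \<le> w ^ (2 + b')"
    proof -
      have "real K + 2 + real B \<le> real B * (8 / g + 6)" using K(4) Bz(3) by (simp add: algebra_simps)
      also have "\<dots> \<le> (2 * (C * w\<^sup>2)) * (8 / g + 6)"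
      proof (intro mult_right_mono)
        have "z \<le> C * w\<^sup>2" unfolding z_def using ypy yw C(1) by (intro mult_left_mono) auto
        then show "real B \<le> 2 * (C * w\<^sup>2)" using Bz(2) by linarith
      qed (use g in auto)
      also have "\<dots> = C4 * w\<^sup>2" by (simp add: C4_def)
      also have "\<dots> \<le> w ^ b' * w\<^sup>2"
      proof (intro mult_right_mono)
        have "(2 :: real) ^ b' \<le> w ^ b'" using w by (intro power_mono) auto
        then show "C4 \<le> w ^ b'" using b' by linarith
      qed auto
      finally show ?thesis unfolding power_add by (simp only: mult.commute)
    qed
    have l: "l > 0" using g by (simp add: l_def)
    have "q \<le> 1 / 2 + 4 * l + 2 * real B / real K + 32 * (real B)\<^sup>2 * real t / (l * m)"
      unfolding m_def
      by (rule computes_low_rank_bound[OF assms(3) kd \<epsilon> _ _ _ _ _ H l K(1,2) L[unfolded w_def] adm comp t])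
        (use assms(4) in \<open>auto simp: M0_def\<close>)
    moreover have "2 * real B / real K \<le> g / 4"
      using K(2,3) g by (simp add: field_simps)
    moreover have "32 * (real B)\<^sup>2 * real t / (l * m) = 512 * (real B)\<^sup>2 * real t / (g * m)"
      using g by (simp add: l_def)
    moreover have "q = 1 / 2 + g" "4 * l = g / 4" by (simp_all add: g_def l_def)
    ultimately have half: "g / 2 \<le> 512 * (real B)\<^sup>2 * real t / (g * m)" by linarith
    have nm: "real n * real d \<le> (real k)\<^sup>2 * m"
    proof -
      have "real n * real d \<le> (real k * real (n - (k - 1))) * (real k * real (d - (k - 1)))"
        using kd assms(3) by (intro mult_mono real_le_mult_diff_pred) auto
      then show ?thesis by (simp add: m_def power2_eq_square mult_ac)
    qed
    have m: "m > 0" using kd by (simp add: m_def)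
    define Y where "Y = y powr (2 / p)"
    have Y: "Y > 0" using y by (simp add: Y_def)
    have B2: "(real B)\<^sup>2 \<le> 4 * C\<^sup>2 * Y"
    proof -
      have "(real B)\<^sup>2 \<le> (2 * z)\<^sup>2" using Bz by (intro power_mono) auto
      also have "\<dots> = 4 * C\<^sup>2 * (y powr (1 / p))\<^sup>2" by (simp add: z_def power_mult_distrib)
      also have "(y powr (1 / p))\<^sup>2 = Y" using y by (simp add: Y_def power2_eq_square powr_add[symmetric])
      finally show ?thesis .
    qed
    have "g\<^sup>2 * (real n * real d) \<le> g\<^sup>2 * ((real k)\<^sup>2 * m)"
      using nm by (intro mult_left_mono) auto
    also have "\<dots> = (real k)\<^sup>2 * (2 * g * m * (g / 2))" by (simp add: power2_eq_square)
    also have "\<dots> \<le> (real k)\<^sup>2 * (2 * g * m * (512 * (real B)\<^sup>2 * real t / (g * m)))"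
      using half g m by (intro mult_left_mono) auto
    also have "\<dots> = 1024 * (real k)\<^sup>2 * real t * (real B)\<^sup>2" using g m by simp
    also have "\<dots> \<le> 1024 * (real k)\<^sup>2 * real t * (4 * C\<^sup>2 * Y)"
      using B2 by (intro mult_left_mono) auto
    finally have "g\<^sup>2 * (real n * real d) \<le> (4096 * C\<^sup>2 * (real k)\<^sup>2) * (real t * Y)"
      by (simp add: mult_ac)
    then have "c * (real n * real d) \<le> real t * Y"
      using C(1) assms(3) by (simp add: c_def pos_divide_le_eq mult_ac)
    then have "c * (real n * real d / Y) \<le> real t"
      using Y by (simp add: pos_divide_le_eq)
    moreover have "real n * real d / Y = (1 + \<epsilon>) powr (- (2 / p)) * real n powr (1 - 1 / p) * real d powr (1 - 4 / p)"
    proof -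
      have "Y = (1 + \<epsilon>) powr (2 / p) * (sqrt (real n)) powr (2 / p) * ((real d)\<^sup>2) powr (2 / p)"
        using \<epsilon> by (simp add: Y_def y_def powr_mult)
      also have "(sqrt (real n)) powr (2 / p) = real n powr (1 / p)"
        using nd by (simp add: powr_half_sqrt[symmetric] powr_powr)
      also have "((real d)\<^sup>2) powr (2 / p) = real d powr (4 / p)"
        using nd by (simp add: powr_numeral[symmetric] powr_powr del: powr_numeral)
      finally show ?thesis
        using nd \<epsilon> by (simp add: powr_diff powr_minus_divide)
    qed
    ultimately show ?thesis by simp
  qed
  \<comment> \<open>No logarithmic factor is lost, hence the exponent \<open>0\<close>.\<close>
  show ?thesis
    by (rule exI[of _ c], rule conjI[OF c], rule exI[of _ 0], rule exI[of _ "2 + b'"])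
      (use main in \<open>simp only: power_0 div_by_1, blast\<close>)
qed

end
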